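(* Let $n\ge1$, $1\le k\le n$ and $m\ge1$ an integer. Then near (generic points of) the divisor $\{q^mt_1\cdots t_k=1\}$ in the region $\{|t_i|>1\ \forall i\}$, $$F(t_1,\ldots,t_n)=(-1)^m\frac{q^{m^2/2}m^{k-1}}{q^mt_1\cdots t_k-1}\cdot\frac{F(t_{k+1},\ldots,t_n)}{(t_{k+1}\cdots t_n)^m}+(\text{a function holomorphic along that divisor}),$$ with the convention $F(t_{k+1},\ldots,t_n)=1$ when $k=n$.
   Context: Fix $q$, $0<|q|<1$, with a chosen $q^{1/2}$. $\langle f\rangle_q:=\sum_\lambda f(\lambda)q^{|\lambda|}/\sum_\lambda q^{|\lambda|}$ over all partitions $\lambda$. $F(t_1,\ldots,t_r)=\big\langle\prod_{k=1}^r\sum_{i\ge1}t_k^{\lambda_i-i+1/2}\big\rangle_q$; this series converges uniformly on compact subsets of $\{|t_i|>1\}$ minus the divisors $q^{m}\prod_{k\in S}t_k=1$ ($m\ge1$, $S\subset\{1,\dots,r\}$), and defines a meromorphic function on $\{|t_i|>1\}$ with at most simple poles along these divisors.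
   Formalization: F needs a choice of each t_j^{1/2} and changes sign with it, so the formula is proved where q^{m/2}(t_1)^{1/2}···(t_k)^{1/2}=+1 (on the other sheet, value −1, the literal sign is wrong); F is taken as the meromorphic continuation of the series from |q t_1···t_n|<1. *)

theory Defs
  imports "HOL-Analysis.Analysis"
begin

text \<open>Points are t :: nat => complex; only the coordinates in a finite index set I
matter.  The topology on nat => complex is the product topology (Function_Topology).
Because of the half-integer exponents, we use square-root coordinates s_i with
t_i = s_i^2; so "t i" below denotes s_i.\<close>

definition partitions :: "(nat \<Rightarrow> nat) set" where
  "partitions = {lam. (\<forall>i j. i \<le> j \<longrightarrow> lam j \<le> lam i) \<and> finite {j. lam j \<noteq> 0}}"

definition psize :: "(nat \<Rightarrow> nat) \<Rightarrow> nat" where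
  "psize lam = sum lam {j. lam j \<noteq> 0}"

text \<open>sum over i >= 1 of t^(lam_i - i + 1/2), with t = s^2, parts lam_i = lam (i-1)\<close>
definition inner_sum :: "complex \<Rightarrow> (nat \<Rightarrow> nat) \<Rightarrow> complex" where
  "inner_sum s lam = (\<Sum>j. s powi (2 * int (lam j) - 2 * int j - 1))"

definition BO_series :: "complex \<Rightarrow> nat set \<Rightarrow> (nat \<Rightarrow> complex) \<Rightarrow> complex" where
  "BO_series q I t =
     (\<Sum>\<^sub>\<infinity>lam\<in>partitions. q ^ psize lam * (\<Prod>k\<in>I. inner_sum (t k) lam))
     / (\<Sum>\<^sub>\<infinity>lam\<in>partitions. q ^ psize lam)"

definition region :: "nat set \<Rightarrow> (nat \<Rightarrow> complex) set" where
  "region I = {t. \<forall>i\<in>I. 1 < norm (t i)}"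

definition divs :: "complex \<Rightarrow> nat set \<Rightarrow> (nat \<Rightarrow> complex) set" where
  "divs q I = {t. \<exists>m::nat. \<exists>S. m \<ge> 1 \<and> S \<subseteq> I \<and> q ^ m * (\<Prod>j\<in>S. (t j)\<^sup>2) = 1}"

text \<open>a nonempty open part of the region where the series converges absolutely\<close>
definition conv_region :: "complex \<Rightarrow> nat set \<Rightarrow> (nat \<Rightarrow> complex) set" where
  "conv_region q I = {t \<in> region I. norm q * (\<Prod>i\<in>I. norm (t i) ^ 2) < 1}"

text \<open>holomorphic in the variables indexed by I (Osgood: continuous and separately
complex differentiable) on the open set U\<close>
definition holo_in :: "nat set \<Rightarrow> (nat \<Rightarrow> complex) set \<Rightarrow> ((nat \<Rightarrow> complex) \<Rightarrow> complex) \<Rightarrow> bool" where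
  "holo_in I U f \<longleftrightarrow> open U \<and> continuous_on U f \<and>
     (\<forall>t\<in>U. \<forall>i\<in>I. (\<lambda>z. f (t(i := z))) field_differentiable (at (t i)))"

end

theory Submission
  imports Defs "HOL-Complex_Analysis.Complex_Analysis"
begin

text \<open>
  Expand the product of the inner sums over functions \<open>i\<close> from the index set to row numbers, and
  describe a partition by the numbers of its columns of each height \<open>l\<close>.  The sum over
  partitions becomes a product of geometric series, so the numerator of \<open>F\<close> is
  \[ \sum_i \prod_j t_j^{-i_j+1/2} \prod_{l\ge1} \frac1{1 - q^l \prod_{i_j\le l} t_j}. \]
  This series converges locally uniformly off the divisors and therefore computes the continuation.
  Its terms that are singular along \<open>q^m t_1 ... t_k = 1\<close> are those with
  \<open>i_1, ..., i_k \<le> m < i_{k+1}, ..., i_n\<close>.  On the divisor, the factors with \<open>l > m\<close> reproduce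
  the series of \<open>F(t_{k+1}, ..., t_n)\<close>, while the sum over \<open>i_1, ..., i_k\<close> of the factors with
  \<open>l < m\<close> is evaluated by grouping the terms into orbits of the cyclic rotation of \<open>{1..m}\<close>.

  Row numbers are counted from 0 below, so the condition \<open>i_j \<le> l\<close> reads \<open>i j < l\<close>.
\<close>

subsection \<open>The residue sum\<close>

text \<open>Where the constants come from: there are \<open>m^k\<close> choices of rows for
  \<open>t_1, ..., t_k\<close>; rotation acts freely on them, so its orbits have \<open>m\<close>
  members, and every orbit has the same sum, which gives \<open>m^(k-1)\<close>. Counting the rows
  of the other coordinates from \<open>m\<close> on produces the power \<open>-m\<close> of their
  product. The sign is \<open>(-1)^(m-1)\<close> from the interpolation formula and one more from
  passing from \<open>1 - x\<close> to \<open>x - 1\<close> in the denominator.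

  In square-root coordinates \<open>s\<close> the divisor has two sheets,
  \<open>r^m s_1 ... s_k = 1\<close> and \<open>= -1\<close>. Each inner sum is odd in its
  \<open>s_j\<close>, so the polar part changes sign between the sheets; the stated formula belongs
  to the first one, and the second has to be kept out of the neighbourhood.

  Two obstacles shape the rest. \<open>F\<close> is known only through its holomorphy and its values
  where the series converges absolutely, so the expansion must be propagated from there. And
  holomorphy includes joint continuity, so it is not enough to remove the singularity on each
  coordinate line separately.\<close>

lemma lagrange_interpolation_of_one:
  fixes D :: "'b \<Rightarrow> complex"
  assumes "finite A" "inj_on D A" "A \<noteq> {}"
  shows "(\<Sum>a\<in>A. \<Prod>b\<in>A - {a}. D b / (D b - D a)) = 1"
proof -
  \<comment> \<open>The Lagrange basis polynomial of the node \<open>D a\<close>; the summand of the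
    claim is its value at 0.\<close>
  define L where "L a = smult (\<Prod>b\<in>A - {a}. 1 / (D a - D b)) (\<Prod>b\<in>A - {a}. [:- D b, 1:])" for a
  have degL: "degree (L a) < card A" if "a \<in> A" for a
  proof -
    have "degree (\<Prod>b\<in>A - {a}. [:- D b, 1:]) \<le> (\<Sum>b\<in>A - {a}. degree [:- D b, 1:])"
      using assms(1) degree_prod_sum_le[of "A - {a}" "\<lambda>b. [:- D b, 1:]"] by (simp add: o_def)
    also have "\<dots> < card A"
      using that assms(1) card_gt_0_iff[of A] by auto
    finally show ?thesis
      unfolding L_def using degree_smult_le order.strict_trans1 by blast
  qed
  have evL: "poly (L a) x = (\<Prod>b\<in>A - {a}. (x - D b) / (D a - D b))" for a x
    by (simp add: L_def poly_prod prod_dividef prod.distrib[symmetric])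
  have evD: "poly (L a) (D c) = (if c = a then 1 else 0)" if "a \<in> A" "c \<in> A" for a c
  proof (cases "c = a")
    case True
    have "D a - D b \<noteq> 0" if "b \<in> A - {a}" for b
      using that \<open>a \<in> A\<close> assms(2) by (auto simp: inj_on_def)
    then show ?thesis unfolding evL using True by (auto intro!: prod.neutral)
  next
    case False
    then show ?thesis unfolding evL using that assms(1) by (auto intro!: prod_zero)
  qed
  \<comment> \<open>Both sides have degree below the number of nodes and agree at every
    node.\<close>
  have "(\<Sum>a\<in>A. L a) = 1"
  proof (rule poly_eqI_degree[where A = "D ` A"])
    fix x assume "x \<in> D ` A"
    then obtain c where c: "c \<in> A" "x = D c" by auto
    have "(\<Sum>a\<in>A. poly (L a) (D c)) = (\<Sum>a\<in>A. if a = c then 1 else 0)"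
      using c by (intro sum.cong) (auto simp: evD)
    then show "poly (\<Sum>a\<in>A. L a) x = poly 1 x"
      using c assms(1) by (simp add: poly_sum)
  next
    have c: "card (D ` A) = card A" using assms by (simp add: card_image)
    have "card A > 0" using assms by (simp add: card_gt_0_iff)
    then show "card (D ` A) > degree (\<Sum>a\<in>A. L a)"
      unfolding c by (intro degree_sum_less degL) auto
    show "card (D ` A) > degree (1 :: complex poly)"
      unfolding c using \<open>card A > 0\<close> by simp
  qed
  then have "(\<Sum>a\<in>A. poly (L a) 0) = 1"
    by (metis poly_1 poly_sum)
  moreover have "poly (L a) 0 = (\<Prod>b\<in>A - {a}. D b / (D b - D a))" for a
    unfolding evL by (intro prod.cong refl) (metis diff_0 minus_diff_eq minus_divide_divide)
  ultimately show ?thesis by simp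
qed

section \<open>Cyclic rotation of row numbers\<close>

definition low :: "nat set \<Rightarrow> (nat \<Rightarrow> nat) \<Rightarrow> nat \<Rightarrow> nat set" where
  "low I i l = {j\<in>I. i j < l}"

definition mon :: "complex \<Rightarrow> (nat \<Rightarrow> complex) \<Rightarrow> nat \<Rightarrow> nat set \<Rightarrow> complex" where
  "mon q t l S = q ^ l * (\<Prod>j\<in>S. (t j)\<^sup>2)"

text \<open>Subtraction of \<open>a\<close> modulo \<open>m\<close>; adding \<open>m\<close> first
  keeps the subtraction of natural numbers from truncating.\<close>

definition rot :: "nat set \<Rightarrow> nat \<Rightarrow> nat \<Rightarrow> (nat \<Rightarrow> nat) \<Rightarrow> nat \<Rightarrow> nat" where
  "rot J m a i = (\<lambda>j\<in>J. (i j + m - a) mod m)"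

text \<open>After rotation the rows below \<open>l\<close> are the old rows in a cyclic window of
  length \<open>l\<close> starting at \<open>a\<close>. If the window does not wrap around, its
  monomial is the quotient of those of two initial segments. If it does, the quotient is off by the
  full monomial \<open>mon q s m J\<close>, which is 1 on the divisor.\<close>

lemma mon_rot:
  assumes J: "finite J" and s: "\<And>j. j \<in> J \<Longrightarrow> s j \<noteq> 0" and q: "q \<noteq> 0"
    and one: "mon q s m J = 1" and i: "i \<in> J \<rightarrow> {..<m}" and a: "a < m" and l: "l < m"
  shows "mon q s l (low J (rot J m a i) l) = mon q s ((l + a) mod m) (low J i ((l + a) mod m)) / mon q s a (low J i a)"
proof -
  have rot: "rot J m a i j = (if a \<le> i j then i j - a else i j + m - a)" if "j \<in> J" for j
  proof -
    have "i j < m" using i that by auto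
    moreover have "(i j + m - a) mod m = i j - a" if "a \<le> i j"
      using that \<open>i j < m\<close>
      by (metis Nat.add_diff_assoc2 less_imp_diff_less mod_add_self2 mod_less)
    ultimately show ?thesis using that a by (auto simp: rot_def)
  qed
  have nz: "mon q s a (low J i a) \<noteq> 0"
    using q s J by (auto simp: mon_def low_def)
  have fin: "finite (low J i b)" for b using J by (auto simp: low_def)
  show ?thesis
  proof (cases "l + a < m")
    case True
    have "low J i (l + a) = low J (rot J m a i) l \<union> low J i a"
      using i True a by (fastforce simp: low_def rot split: if_splits)
    moreover have "low J (rot J m a i) l \<inter> low J i a = {}"
      using True a by (auto simp: low_def rot split: if_splits)
    ultimately have "mon q s (l + a) (low J i (l + a)) = mon q s l (low J (rot J m a i) l) * mon q s a (low J i a)"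
      using J by (simp add: mon_def prod.union_disjoint power_add low_def)
    then show ?thesis using True nz by (simp add: field_simps)
  next
    case False
    then have md: "(l + a) mod m = l + a - m" using a l by (simp add: mod_if)
    define b where "b = l + a - m"
    have b: "b + m = l + a" "b < a" using False l a by (auto simp: b_def)
    have 1: "low J (rot J m a i) l = (J - low J i a) \<union> low J i b"
    proof -
      have "rot J m a i j < l \<longleftrightarrow> \<not> i j < a \<or> i j < b" if "j \<in> J" for j
      proof -
        have "i j < m" using i that by auto
        then show ?thesis using b a l that by (auto simp: rot)
      qed
      then show ?thesis using b by (auto simp: low_def)
    qed
    have 2: "(J - low J i a) \<inter> low J i b = {}" using b by (auto simp: low_def)
    have 3: "(\<Prod>j\<in>J. (s j)\<^sup>2) = (\<Prod>j\<in>J - low J i a. (s j)\<^sup>2) * (\<Prod>j\<in>low J i a. (s j)\<^sup>2)"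
      using J by (subst prod.subset_diff[of "low J i a"]) (auto simp: low_def)
    have "mon q s l (low J (rot J m a i) l) * mon q s a (low J i a) = q ^ (l + a) * (\<Prod>j\<in>J. (s j)\<^sup>2) * (\<Prod>j\<in>low J i b. (s j)\<^sup>2)"
      unfolding mon_def 1 3 using J 2 fin by (subst prod.union_disjoint) (auto simp: power_add)
    also have "\<dots> = mon q s b (low J i b)"
      using one unfolding b(1)[symmetric] by (simp add: mon_def power_add)
    finally show ?thesis using nz md by (simp add: b_def field_simps)
  qed
qed

lemma rot_bij:
  assumes "a < m"
  shows "bij_betw (rot J m a) (J \<rightarrow>\<^sub>E {..<m}) (J \<rightarrow>\<^sub>E {..<m})"
proof (rule bij_betwI[where g = "rot J m (m - a)"])
  have pos: "m > 0" using assms by simp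
  have inv: "((x + m - a) mod m + m - (m - a)) mod m = x" "((x + m - (m - a)) mod m + m - a) mod m = x" if "x < m" for x :: nat
  proof -
    have "(x + m - a) mod m + m - (m - a) = (x + m - a) mod m + a" "x + m - (m - a) = x + a" using assms by auto
    then show "((x + m - a) mod m + m - (m - a)) mod m = x"
      using assms that by (simp add: mod_add_left_eq)
    have "(x + a) mod m = (if x + a < m then x + a else x + a - m)"
      using assms that by (simp add: mod_if)
    then show "((x + m - (m - a)) mod m + m - a) mod m = x"
      using assms that \<open>x + m - (m - a) = x + a\<close> by (auto simp: mod_if)
  qed
  show "rot J m a \<in> (J \<rightarrow>\<^sub>E {..<m}) \<rightarrow> (J \<rightarrow>\<^sub>E {..<m})"
       "rot J m (m - a) \<in> (J \<rightarrow>\<^sub>E {..<m}) \<rightarrow> (J \<rightarrow>\<^sub>E {..<m})"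
    using pos unfolding rot_def by (auto simp del: mod_less)
  show "rot J m (m - a) (rot J m a x) = x" if "x \<in> J \<rightarrow>\<^sub>E {..<m}" for x
    proof
    fix j show "rot J m (m - a) (rot J m a x) j = x j"
      using PiE_mem[OF that, of j] PiE_arb[OF that, of j] inv(1)[of "x j"]
      by (cases "j \<in> J") (simp_all only: rot_def restrict_apply lessThan_iff if_True if_False simp_thms)
  qed
  show "rot J m a (rot J m (m - a) x) = x" if "x \<in> J \<rightarrow>\<^sub>E {..<m}" for x
    proof
    fix j show "rot J m a (rot J m (m - a) x) j = x j"
      using PiE_mem[OF that, of j] PiE_arb[OF that, of j] inv(2)[of "x j"]
      by (cases "j \<in> J") (simp_all only: rot_def restrict_apply lessThan_iff if_True if_False simp_thms)
  qed
qed

text \<open>The coordinate \<open>s j\<close> enters the factors with \<open>i j < l < m\<close>,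
  hence with exponent \<open>2 * (m - 1 - i j)\<close>. This exceeds
  \<open>- 2 * int (i j) - 1\<close> by \<open>2 * m - 1\<close>, the same for all \<open>j\<close>,
  so the excess and the powers of \<open>r\<close> combine to
  \<open>(r ^ m * (\<Prod>j\<in>J. s j)) ^ (2 * m - 1) = 1\<close>. As this exponent is odd, the
  equation of the divisor is needed in its square-root form.\<close>

lemma monomial_eq_prod_mon:
  assumes J: "finite J" and r: "r\<^sup>2 = q" and one: "r ^ m * (\<Prod>j\<in>J. s j) = 1" and m: "1 \<le> m"
    and i: "i \<in> J \<rightarrow> {..<m}"
  shows "(\<Prod>j\<in>J. s j powi (- 2 * int (i j) - 1)) = r ^ (m\<^sup>2) * (\<Prod>l=1..<m. mon q s l (low J i l))"
proof -
  have s: "s j \<noteq> 0" if "j \<in> J" for j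
    using one J that by (metis mult_zero_right prod_zero_iff zero_neq_one)
  have "(\<Prod>l=1..<m. \<Prod>j\<in>low J i l. (s j)\<^sup>2) = (\<Prod>l=1..<m. \<Prod>j\<in>J. if i j < l then (s j)\<^sup>2 else 1)"
    unfolding low_def using J by (simp add: prod.inter_filter)
  also have "\<dots> = (\<Prod>j\<in>J. \<Prod>l=1..<m. if i j < l then (s j)\<^sup>2 else 1)"
    by (rule prod.swap)
  also have "\<dots> = (\<Prod>j\<in>J. (s j) ^ (2 * (m - 1 - i j)))"
  proof (intro prod.cong refl)
    fix j assume "j \<in> J"
    have "{l \<in> {1..<m}. i j < l} = {Suc (i j)..<m}" by auto
    then show "(\<Prod>l=1..<m. if i j < l then (s j)\<^sup>2 else 1) = (s j) ^ (2 * (m - 1 - i j))"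
      by (simp add: prod.inter_filter[symmetric] power_mult)
  qed
  also have "\<dots> = (\<Prod>j\<in>J. s j powi (- 2 * int (i j) - 1) * s j ^ (2 * m - 1))"
  proof (intro prod.cong refl)
    fix j assume j: "j \<in> J"
    then have "i j < m" using i by auto
    then have "int (2 * (m - 1 - i j)) = (- 2 * int (i j) - 1) + int (2 * m - 1)"
      by (simp add: of_nat_diff algebra_simps)
    then show "s j ^ (2 * (m - 1 - i j)) = s j powi (- 2 * int (i j) - 1) * s j ^ (2 * m - 1)"
      using s[OF j] by (metis power_int_add power_int_of_nat)
  qed
  also have "\<dots> = (\<Prod>j\<in>J. s j powi (- 2 * int (i j) - 1)) * (\<Prod>j\<in>J. s j) ^ (2 * m - 1)"
    by (simp add: prod.distrib prod_power_distrib)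
  finally have 1: "(\<Prod>l=1..<m. \<Prod>j\<in>low J i l. (s j)\<^sup>2) = \<dots>" .
  have "(\<Prod>l=1..<m. q ^ l) = r ^ (m * (m - 1))"
  proof -
    have "2 * (\<Sum>l=1..<Suc n. l) = Suc n * n" for n by (induction n) auto
    from this[of "m - 1"] have "2 * (\<Sum>l=1..<m. l) = m * (m - 1)" using m by simp
    then show ?thesis unfolding r[symmetric] by (metis (no_types, lifting) power_mult power_sum prod.cong)
  qed
  then have "r ^ (m\<^sup>2) * (\<Prod>l=1..<m. mon q s l (low J i l)) =
      (\<Prod>j\<in>J. s j powi (- 2 * int (i j) - 1)) * (r ^ (m\<^sup>2) * r ^ (m * (m - 1)) * (\<Prod>j\<in>J. s j) ^ (2 * m - 1))"
    unfolding mon_def prod.distrib 1 by simp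
  also have "r ^ (m\<^sup>2) * r ^ (m * (m - 1)) = (r ^ m) ^ (2 * m - 1)"
  proof -
    have "m\<^sup>2 + m * (m - 1) = m * (2 * m - 1)" using m by (cases m) (auto simp: power2_eq_square algebra_simps)
    then show ?thesis by (simp add: power_add[symmetric] power_mult[symmetric])
  qed
  also have "(r ^ m) ^ (2 * m - 1) * (\<Prod>j\<in>J. s j) ^ (2 * m - 1) = 1"
    by (simp add: power_mult_distrib[symmetric] one)
  finally show ?thesis by simp
qed

text \<open>
  Each summand equals \<open>r ^ m\<^sup>2 * (\<Prod>l=1..<m. D l / (1 - D l))\<close> with
  \<open>D l = mon q s l (low J i l)\<close>.  Since \<open>D m = 1\<close>, rotating \<open>i\<close> by \<open>a\<close> replaces the
  \<open>D l\<close> by \<open>D (l + a) / D a\<close>, so a full rotation orbit adds up to a Lagrange interpolation of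
  the constant 1 at 0.
\<close>

lemma sum_terms_on_divisor:
  assumes J: "finite J" "J \<noteq> {}" and q0: "q \<noteq> 0" and r: "r\<^sup>2 = q" and one: "r ^ m * (\<Prod>j\<in>J. s j) = 1" and m: "1 \<le> m"
    and gen: "\<And>l S. 1 \<le> l \<Longrightarrow> l < m \<Longrightarrow> S \<subseteq> J \<Longrightarrow> mon q s l S \<noteq> 1"
  shows "(\<Sum>i\<in>J \<rightarrow>\<^sub>E {..<m}. (\<Prod>j\<in>J. s j powi (- 2 * int (i j) - 1)) * (\<Prod>l=1..<m. 1 / (1 - mon q s l (low J i l))))
       = (-1) ^ (m - 1) * r ^ (m\<^sup>2) * of_nat m ^ (card J - 1)"
proof -
  define h where "h i = (\<Prod>j\<in>J. s j powi (- 2 * int (i j) - 1)) * (\<Prod>l=1..<m. 1 / (1 - mon q s l (low J i l)))" for i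
  define D where "D i l = mon q s l (low J i l)" for i l
  have s: "s j \<noteq> 0" if "j \<in> J" for j
    using one J that by (metis mult_zero_right prod_zero_iff zero_neq_one)
  have one': "mon q s m J = 1"
  proof -
    have "mon q s m J = (r ^ m * (\<Prod>j\<in>J. s j))\<^sup>2"
      by (simp add: mon_def r[symmetric] power_mult_distrib prod_power_distrib power_mult[symmetric] mult.commute)
    then show ?thesis using one by simp
  qed
  have h: "h i = r ^ (m\<^sup>2) * (\<Prod>l=1..<m. D i l / (1 - D i l))" if "i \<in> J \<rightarrow> {..<m}" for i
    unfolding h_def D_def monomial_eq_prod_mon[OF J(1) r one m that] by (simp add: prod_dividef)
  have Dnz: "D i l \<noteq> 0" for i l
    unfolding D_def mon_def low_def using q0 s J by auto
  \<comment> \<open>At \<open>d = y\<close> both sides are 0 by the convention for division by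
    zero.\<close>
  have frac: "(y / d) / (1 - y / d) = y / (d - y)" if "d \<noteq> 0" for y d :: complex
    using that by (cases "d = y") (auto simp: field_simps)
  have hrot: "h (rot J m a i) = r ^ (m\<^sup>2) * ((-1) ^ (m - 1) * (\<Prod>b\<in>{..<m} - {a}. D i b / (D i b - D i a)))"
    if i: "i \<in> J \<rightarrow>\<^sub>E {..<m}" and a: "a < m" for i a
  proof -
    have i': "i \<in> J \<rightarrow> {..<m}" using i by auto
    have rm: "rot J m a i \<in> J \<rightarrow> {..<m}" using m by (auto simp: rot_def)
    have "(\<Prod>l=1..<m. D (rot J m a i) l / (1 - D (rot J m a i) l)) = (\<Prod>l=1..<m. D i ((l + a) mod m) / (D i a - D i ((l + a) mod m)))"
    proof (intro prod.cong refl)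
      fix l assume "l \<in> {1..<m}"
      then have "D (rot J m a i) l = D i ((l + a) mod m) / D i a"
        unfolding D_def by (intro mon_rot J(1) s q0 one' i' a) auto
      then show "D (rot J m a i) l / (1 - D (rot J m a i) l) = D i ((l + a) mod m) / (D i a - D i ((l + a) mod m))"
        using frac[OF Dnz[of i a]] by simp
    qed
    also have "\<dots> = (\<Prod>b\<in>{..<m} - {a}. D i b / (D i a - D i b))"
    proof (rule prod.reindex_bij_betw)
      show "bij_betw (\<lambda>l. (l + a) mod m) {1..<m} ({..<m} - {a})"
      proof (rule bij_betwI[where g = "\<lambda>b. (b + m - a) mod m"])
        have e1: "(l + a) mod m = (if l + a < m then l + a else l + a - m)" if "l < m" for l
          using a that by (simp add: mod_if)
        have e2: "(b + m - a) mod m = (if b < a then b + m - a else b - a)" if "b < m" for b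
          using a that by (simp add: mod_if)
        show "(\<lambda>l. (l + a) mod m) \<in> {1..<m} \<rightarrow> {..<m} - {a}" using a by (auto simp: e1 split: if_splits)
        show "(\<lambda>b. (b + m - a) mod m) \<in> {..<m} - {a} \<rightarrow> {1..<m}" using a by (auto simp: e2 split: if_splits)
        show "((l + a) mod m + m - a) mod m = l" if "l \<in> {1..<m}" for l
          using that a e1[of l] by (subst e2) auto
        show "((b + m - a) mod m + a) mod m = b" if "b \<in> {..<m} - {a}" for b
          using that a e2[of b] by (subst e1) auto
      qed
    qed
    also have "\<dots> = (\<Prod>b\<in>{..<m} - {a}. (-1) * (D i b / (D i b - D i a)))"
      by (intro prod.cong refl) (metis minus_diff_eq minus_divide_right mult_minus1)
    also have "\<dots> = (-1) ^ (m - 1) * (\<Prod>b\<in>{..<m} - {a}. D i b / (D i b - D i a))"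
      using a by (subst prod.distrib) simp
    finally show ?thesis unfolding h[OF rm] by simp
  qed
  \<comment> \<open>Genericity makes the nodes distinct: for \<open>a < b\<close> the ratio
    \<open>D i b / D i a\<close> is again a monomial \<open>mon q s (b - a) S\<close> with
    \<open>1 \<le> b - a < m\<close>.\<close>
  have inj: "inj_on (D i) {..<m}" if "i \<in> J \<rightarrow>\<^sub>E {..<m}" for i
  proof -
    have "D i a \<noteq> D i b" if ab: "a < b" "b < m" for a b
    proof -
      have "low J i b = (low J i b - low J i a) \<union> low J i a" using ab by (auto simp: low_def)
      then have "D i b = mon q s (b - a) (low J i b - low J i a) * D i a"
        using ab J(1) unfolding D_def mon_def
        by (subst prod.subset_diff[of "low J i a"]) (auto simp: low_def power_add[symmetric])
      moreover have "mon q s (b - a) (low J i b - low J i a) \<noteq> 1"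
        using ab by (intro gen) (auto simp: low_def)
      ultimately show ?thesis using Dnz[of i a] by simp
    qed
    then show ?thesis by (metis inj_onI lessThan_iff linorder_neqE_nat)
  qed
  have sumrot: "(\<Sum>a<m. h (rot J m a i)) = (-1) ^ (m - 1) * r ^ (m\<^sup>2)" if i: "i \<in> J \<rightarrow>\<^sub>E {..<m}" for i
    using hrot[OF i] lagrange_interpolation_of_one[OF _ inj[OF i]] m
    by (simp add: sum_distrib_left[symmetric] mult.assoc[symmetric] lessThan_empty_iff)
  \<comment> \<open>Double counting: \<open>m\<close> copies of the sum, the copy number
    \<open>a\<close> reindexed by rotation by \<open>a\<close>. For each \<open>i\<close> the sum
    over \<open>a\<close> is a constant, and there are \<open>m ^ card J\<close> functions
    \<open>i\<close>; cancelling \<open>m\<close> lowers the exponent by one.\<close>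
  have "of_nat m * (\<Sum>i\<in>J \<rightarrow>\<^sub>E {..<m}. h i) = (\<Sum>a<m. \<Sum>i\<in>J \<rightarrow>\<^sub>E {..<m}. h i)"
    by simp
  also have "\<dots> = (\<Sum>a<m. \<Sum>i\<in>J \<rightarrow>\<^sub>E {..<m}. h (rot J m a i))"
    by (intro sum.cong refl sum.reindex_bij_betw[symmetric] rot_bij) auto
  also have "\<dots> = (\<Sum>i\<in>J \<rightarrow>\<^sub>E {..<m}. \<Sum>a<m. h (rot J m a i))"
    by (rule sum.swap)
  also have "\<dots> = of_nat (card (J \<rightarrow>\<^sub>E {..<m})) * ((-1) ^ (m - 1) * r ^ (m\<^sup>2))"
    by (simp add: sumrot)
  also have "card (J \<rightarrow>\<^sub>E {..<m}) = m * m ^ (card J - 1)"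
    using J by (simp add: card_PiE card_gt_0_iff flip: power_Suc)
  finally show ?thesis using m unfolding h_def by simp
qed

subsection \<open>Sums over partitions\<close>

definition plen :: "nat \<Rightarrow> (nat \<Rightarrow> nat) set" where
  "plen L = {lam \<in> partitions. \<forall>j\<ge>L. lam j = 0}"

lemma plen_0: "plen 0 = {\<lambda>_. 0}"
  by (auto simp: plen_def partitions_def)

lemma plen_mono: "L \<le> M \<Longrightarrow> plen L \<subseteq> plen M"
  by (auto simp: plen_def)

lemma plen_partitions: "plen L \<subseteq> partitions"
  by (auto simp: plen_def)

lemma finite_subset_plen:
  assumes "finite A" "A \<subseteq> partitions"
  shows "\<exists>L. A \<subseteq> plen L"
  using assms
proof (induction A rule: finite_induct)
  case empty
  then show ?case by auto
next
  case (insert lam A)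
  then obtain L where L: "A \<subseteq> plen L" by auto
  have "finite {j. lam j \<noteq> 0}" using insert.prems by (auto simp: partitions_def)
  then obtain M where M: "\<forall>j\<in>{j. lam j \<noteq> 0}. j < M"
    using finite_nat_set_iff_bounded by auto
  have "lam \<in> plen M" using M insert.prems by (force simp: plen_def)
  then have "insert lam A \<subseteq> plen (max L M)"
    using L plen_mono[of L "max L M"] plen_mono[of M "max L M"] by auto
  then show ?case by blast
qed

lemma psize_plen: "lam \<in> plen L \<Longrightarrow> psize lam = (\<Sum>j<L. lam j)"
  unfolding psize_def by (rule sum.mono_neutral_left) (auto simp: plen_def intro: leI)

text \<open>Adds \<open>a\<close> columns of height \<open>L + 1\<close> to a Young diagram with at most \<open>L\<close> rows.\<close>

definition add_col :: "nat \<Rightarrow> (nat \<Rightarrow> nat) \<times> nat \<Rightarrow> nat \<Rightarrow> nat" where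
  "add_col L = (\<lambda>(mu, a) j. mu j + (if j \<le> L then a else 0))"

lemma add_col_plen:
  assumes "mu \<in> plen L"
  shows "add_col L (mu, a) \<in> plen (Suc L)"
proof -
  have "{j. add_col L (mu, a) j \<noteq> 0} \<subseteq> {..L}"
    using assms by (auto simp: plen_def add_col_def split: if_splits intro: ccontr)
  then have "finite {j. add_col L (mu, a) j \<noteq> 0}" by (rule finite_subset) auto
  moreover have "add_col L (mu, a) j \<le> add_col L (mu, a) i" if "i \<le> j" for i j
    using that assms by (auto simp: plen_def partitions_def add_col_def)
  ultimately show ?thesis
    using assms by (auto simp: plen_def partitions_def add_col_def)
qed

lemma bij_add_col: "bij_betw (add_col L) (plen L \<times> UNIV) (plen (Suc L))"
\<comment> \<open>The inverse reads off \<open>lam L\<close>, the last row, as the number of columns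
  of full height \<open>L + 1\<close>.\<close>
proof (rule bij_betwI[where g = "\<lambda>lam. (\<lambda>j. if j \<le> L then lam j - lam L else 0, lam L)"])
  show "add_col L \<in> plen L \<times> UNIV \<rightarrow> plen (Suc L)"
    using add_col_plen by auto
  show "(\<lambda>lam. (\<lambda>j. if j \<le> L then lam j - lam L else 0, lam L)) \<in> plen (Suc L) \<rightarrow> plen L \<times> UNIV"
  proof
    fix lam assume lam: "lam \<in> plen (Suc L)"
    define mu where "mu = (\<lambda>j. if j \<le> L then lam j - lam L else 0)"
    have "finite {j. mu j \<noteq> 0}"
      by (rule finite_subset[of _ "{..L}"]) (auto simp: mu_def)
    moreover have "mu j \<le> mu i" if "i \<le> j" for i j
      using lam that by (auto simp: mu_def plen_def partitions_def intro!: diff_le_mono)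
    ultimately have "mu \<in> plen L" by (auto simp: plen_def partitions_def mu_def)
    then show "(\<lambda>j. if j \<le> L then lam j - lam L else 0, lam L) \<in> plen L \<times> UNIV"
      by (simp add: mu_def)
  qed
  show "(\<lambda>j. if j \<le> L then add_col L p j - add_col L p L else 0, add_col L p L) = p"
    if "p \<in> plen L \<times> UNIV" for p
    using that by (cases p) (auto simp: add_col_def plen_def fun_eq_iff)
  show "add_col L (\<lambda>j. if j \<le> L then lam j - lam L else 0, lam L) = lam" if "lam \<in> plen (Suc L)" for lam
    using that by (auto simp: add_col_def plen_def partitions_def fun_eq_iff)
qed

lemma geometric_has_sum:
  fixes x :: "'a::{real_normed_field, banach}"
  assumes "norm x < 1"
  shows "((\<lambda>a. x ^ a) has_sum (1 / (1 - x))) UNIV"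
  using assms geometric_sums[of x]
  by (intro norm_summable_imp_has_sum) (auto simp: norm_power summable_geometric)

text \<open>Allowing one more row multiplies the sum by a geometric series in \<open>x L\<close>.
  Absolute summability is carried through the induction because the double sum over
  \<open>plen L\<close> and the number of new columns needs it. The value type is general so that
  the lemma also applies to the norms of \<open>w\<close> and \<open>x\<close>.\<close>

lemma plen_has_sum:
  fixes w :: "(nat \<Rightarrow> nat) \<Rightarrow> 'a::{real_normed_field, banach}"
  assumes w0: "w (\<lambda>_. 0) = 1"
    and step: "\<And>L mu a. mu \<in> plen L \<Longrightarrow> w (add_col L (mu, a)) = w mu * x L ^ a"
    and x: "\<And>l. norm (x l) < 1"
  shows "(\<lambda>lam. norm (w lam)) summable_on plen L \<and> (w has_sum (\<Prod>l<L. 1 / (1 - x l))) (plen L)"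
proof (induction L)
  case 0
  then show ?case using w0 by (auto simp: plen_0 has_sum_finite_iff)
next
  case (Suc L)
  let ?f = "\<lambda>p. w (fst p) * x L ^ (snd p)"
  have nx: "((\<lambda>a. norm (x L) ^ a) has_sum (1 / (1 - norm (x L)))) UNIV"
    using x[of L] by (intro geometric_has_sum) auto
  have abs: "(\<lambda>p. norm (?f p)) summable_on (plen L \<times> UNIV)"
  proof (subst Infinite_Sum.abs_summable_on_Sigma_iff, intro conjI ballI)
    fix mu assume "mu \<in> plen L"
    show "(\<lambda>y. norm (?f (mu, y))) summable_on UNIV"
      using has_sum_imp_summable[OF nx] by (auto simp: norm_mult norm_power intro: summable_on_cmult_right)
  next
    have "(\<Sum>\<^sub>\<infinity>y. norm (?f (mu, y))) = norm (w mu) * (1 / (1 - norm (x L)))" for mu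
      using infsumI[OF nx] by (simp add: norm_mult norm_power infsum_cmult_right')
    moreover have "(\<lambda>mu. norm (w mu) * (1 / (1 - norm (x L)))) summable_on plen L"
      using Suc.IH by (intro summable_on_cmult_left) auto
    ultimately show "(\<lambda>mu. norm (\<Sum>\<^sub>\<infinity>y. norm (?f (mu, y)))) summable_on plen L"
      using x[of L] by (simp add: norm_mult)
  qed
  have eq: "w (add_col L p) = ?f p" if "p \<in> plen L \<times> UNIV" for p
    using that step by auto
  have hs: "(?f has_sum (\<Prod>l<L. 1 / (1 - x l)) * (1 / (1 - x L))) (plen L \<times> UNIV)"
  proof (rule has_sum_SigmaI)
    show "((\<lambda>y. ?f (mu, y)) has_sum (w mu * (1 / (1 - x L)))) UNIV" if "mu \<in> plen L" for mu
      using has_sum_cmult_right[OF geometric_has_sum[OF x[of L]], of "w mu"] by simp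
    show "((\<lambda>mu. w mu * (1 / (1 - x L))) has_sum (\<Prod>l<L. 1 / (1 - x l)) * (1 / (1 - x L))) (plen L)"
      using Suc.IH by (intro has_sum_cmult_left) auto
    show "?f summable_on plen L \<times> UNIV"
      by (rule abs_summable_summable[OF abs])
  qed
  have "((\<lambda>p. w (add_col L p)) has_sum (\<Prod>l<Suc L. 1 / (1 - x l))) (plen L \<times> UNIV)"
    using hs by (subst has_sum_cong[OF eq]) auto
  moreover have "(\<lambda>p. norm (w (add_col L p))) summable_on (plen L \<times> UNIV)"
    using abs by (subst summable_on_cong[where g = "\<lambda>p. norm (?f p)"]) (auto simp: eq)
  ultimately show ?case
    using has_sum_reindex_bij_betw[OF bij_add_col[of L], of w]
      summable_on_reindex_bij_betw[OF bij_add_col[of L], of "\<lambda>p. norm (w p)"] by auto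
qed

text \<open>A finite set of partitions lies in some \<open>plen L\<close>, so the bound on the
  products of norms bounds all finite sums of norms. The error of the product over
  \<open>l < L\<close> is a sum over the partitions with more than \<open>L\<close> rows, hence at
  most a tail of the absolutely convergent series.\<close>

lemma partitions_has_sum:
  fixes w :: "(nat \<Rightarrow> nat) \<Rightarrow> 'a::{real_normed_field, banach}"
  assumes w0: "w (\<lambda>_. 0) = 1"
    and step: "\<And>L mu a. mu \<in> plen L \<Longrightarrow> w (add_col L (mu, a)) = w mu * x L ^ a"
    and x: "\<And>l. norm (x l) < 1"
    and C: "\<And>L. (\<Prod>l<L. 1 / (1 - norm (x l))) \<le> C"
  shows "(\<lambda>lam. norm (w lam)) summable_on partitions"
    and "(\<Sum>\<^sub>\<infinity>lam\<in>partitions. norm (w lam)) \<le> C"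
    and "(\<lambda>L. \<Prod>l<L. 1 / (1 - x l)) \<longlonglongrightarrow> (\<Sum>\<^sub>\<infinity>lam\<in>partitions. w lam)"
proof -
  have nw: "(\<lambda>lam. norm (norm (w lam))) summable_on plen L \<and> ((\<lambda>lam. norm (w lam)) has_sum (\<Prod>l<L. 1 / (1 - norm (x l)))) (plen L)" for L
    by (rule plen_has_sum) (use w0 step x in \<open>auto simp: norm_mult norm_power\<close>)
  have le: "sum (\<lambda>lam. norm (w lam)) A \<le> C" if A: "finite A" "A \<subseteq> partitions" for A
  proof -
    obtain L where L: "A \<subseteq> plen L" using finite_subset_plen[OF A] by auto
    have "sum (\<lambda>lam. norm (w lam)) A \<le> (\<Prod>l<L. 1 / (1 - norm (x l)))"
      by (rule finite_sum_le_has_sum[OF conjunct2[OF nw[of L]]]) (use A L in auto)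
    then show ?thesis using C[of L] by simp
  qed
  show abs: "(\<lambda>lam. norm (w lam)) summable_on partitions"
    by (rule nonneg_bdd_above_summable_on) (use le in \<open>auto intro!: bdd_aboveI2[where M = C]\<close>)
  show "(\<Sum>\<^sub>\<infinity>lam\<in>partitions. norm (w lam)) \<le> C"
    by (rule infsum_le_finite_sums) (use abs le in auto)
  have pl: "(\<lambda>lam. norm (w lam)) summable_on plen L" "infsum w (plen L) = (\<Prod>l<L. 1 / (1 - x l))" for L
    using plen_has_sum[of w x L, OF w0 step x] by (auto simp: infsumI)
  have dif: "(\<lambda>lam. norm (w lam)) summable_on partitions - plen L" for L
    using abs by (rule summable_on_subset_banach) auto
  have split: "infsum f partitions = infsum f (plen L) + infsum f (partitions - plen L)"
    if "f summable_on (plen L)" "f summable_on (partitions - plen L)" for f :: "_ \<Rightarrow> 'c::banach" and L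
    using infsum_Un_disjoint[OF that] plen_partitions[of L] by (simp add: Un_absorb1 Un_Diff_cancel)
  show "(\<lambda>L. \<Prod>l<L. 1 / (1 - x l)) \<longlonglongrightarrow> (\<Sum>\<^sub>\<infinity>lam\<in>partitions. w lam)"
  proof (rule LIMSEQ_I)
    fix e :: real assume "e > 0"
    then obtain A where A: "finite A" "A \<subseteq> partitions"
      "dist (sum (\<lambda>lam. norm (w lam)) A) (\<Sum>\<^sub>\<infinity>lam\<in>partitions. norm (w lam)) \<le> e / 2"
      using infsum_finite_approximation[OF abs, of "e / 2"] by auto
    obtain L0 where L0: "A \<subseteq> plen L0" using finite_subset_plen[OF A(1,2)] by auto
    have "norm ((\<Prod>l<L. 1 / (1 - x l)) - (\<Sum>\<^sub>\<infinity>lam\<in>partitions. w lam)) < e" if "L \<ge> L0" for L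
    proof -
      have "norm ((\<Prod>l<L. 1 / (1 - x l)) - (\<Sum>\<^sub>\<infinity>lam\<in>partitions. w lam)) = norm (infsum w (partitions - plen L))"
        using split[of w L] pl(2)[of L] abs_summable_summable[OF pl(1)[of L]] abs_summable_summable[OF dif[of L]] by (simp add: norm_minus_commute)
      also have "\<dots> \<le> (\<Sum>\<^sub>\<infinity>lam\<in>partitions - plen L. norm (w lam))"
        by (rule norm_infsum_bound) (use dif in auto)
      also have "\<dots> = (\<Sum>\<^sub>\<infinity>lam\<in>partitions. norm (w lam)) - (\<Sum>\<^sub>\<infinity>lam\<in>plen L. norm (w lam))"
        using split[of "\<lambda>lam. norm (w lam)" L] pl(1)[of L] dif[of L] by simp
      also have "\<dots> \<le> (\<Sum>\<^sub>\<infinity>lam\<in>partitions. norm (w lam)) - sum (\<lambda>lam. norm (w lam)) A"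
        using L0 plen_mono[OF that] A pl(1)[of L] by (intro diff_left_mono finite_sum_le_infsum) auto
      also have "\<dots> \<le> e / 2" using A(3) unfolding dist_real_def by linarith
      finally show ?thesis using \<open>e > 0\<close> by linarith
    qed
    then show "\<exists>L0. \<forall>L\<ge>L0. norm ((\<Prod>l<L. 1 / (1 - x l)) - (\<Sum>\<^sub>\<infinity>lam\<in>partitions. w lam)) < e" by blast
  qed
qed

section \<open>The expanded series and the interchange of summations\<close>

text \<open>A finite set of functions lies in a product of finite sets, over which the sum
  factorizes into sums bounded by the full one-variable sums.\<close>

lemma summable_on_prod_PiE:
  fixes f :: "'a \<Rightarrow> 'b \<Rightarrow> real"
  assumes I: "finite I" and f: "\<And>x. x \<in> I \<Longrightarrow> f x summable_on B x" "\<And>x y. 0 \<le> f x y"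
  shows "(\<lambda>g. \<Prod>x\<in>I. f x (g x)) summable_on PiE I B"
proof (rule nonneg_bdd_above_summable_on)
  show "bdd_above (sum (\<lambda>g. \<Prod>x\<in>I. f x (g x)) ` {F. F \<subseteq> PiE I B \<and> finite F})"
  proof (rule bdd_aboveI2)
    fix F assume "F \<in> {F. F \<subseteq> PiE I B \<and> finite F}"
    then have F: "F \<subseteq> PiE I B" "finite F" by auto
    define B' where "B' x = (\<lambda>g. g x) ` F" for x
    have B': "finite (B' x)" for x using F by (simp add: B'_def)
    have sub: "B' x \<subseteq> B x" if "x \<in> I" for x using F that by (auto simp: B'_def)
    have "F \<subseteq> PiE I B'" 
    proof
      fix g assume g: "g \<in> F"
      then have "g \<in> PiE I B" using F(1) by blast
      then show "g \<in> PiE I B'" using g by (intro PiE_I) (auto simp: B'_def dest: PiE_arb)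
    qed
    then have "sum (\<lambda>g. \<Prod>x\<in>I. f x (g x)) F \<le> sum (\<lambda>g. \<Prod>x\<in>I. f x (g x)) (PiE I B')"
      using I B' f(2) by (intro sum_mono2 finite_PiE prod_nonneg) auto
    also have "\<dots> = (\<Prod>x\<in>I. \<Sum>y\<in>B' x. f x y)"
      using I B' by (intro prod_sum_PiE[symmetric]) auto
    also have "\<dots> \<le> (\<Prod>x\<in>I. infsum (f x) (B x))"
      using f sub B' by (intro prod_mono conjI sum_nonneg finite_sum_le_infsum) auto
    finally show "sum (\<lambda>g. \<Prod>x\<in>I. f x (g x)) F \<le> (\<Prod>x\<in>I. infsum (f x) (B x))" .
  qed
qed (simp add: prod_nonneg f(2))

text \<open>
  The exclusion set \<open>X\<close> is empty for the series itself; \<open>X = {(m, J)}\<close> strips off the one factor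
  that is singular along the divisor under consideration.
\<close>

definition fac :: "complex \<Rightarrow> (nat \<times> nat set) set \<Rightarrow> (nat \<Rightarrow> complex) \<Rightarrow> nat \<Rightarrow> nat set \<Rightarrow> complex" where
  "fac q X t l S = (if (l, S) \<in> X then 1 else 1 / (1 - mon q t l S))"

text \<open>Row \<open>i j\<close> counted from 0 is row \<open>i j + 1\<close> counted from 1, so
  the exponent of the original variable is \<open>-i j - 1/2\<close>, which doubles in the
  square-root coordinate.\<close>

definition monom_part :: "nat set \<Rightarrow> (nat \<Rightarrow> nat) \<Rightarrow> (nat \<Rightarrow> complex) \<Rightarrow> complex" where
  "monom_part I i t = (\<Prod>j\<in>I. t j powi (- 2 * int (i j) - 1))"

text \<open>\<open>Suc l\<close> is the column height, which starts at 1. The value of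
  \<open>lim\<close> is meaningful only where the products converge; this is established separately,
  off the divisors that are not excluded by \<open>X\<close>.\<close>

definition bo_term :: "complex \<Rightarrow> (nat \<times> nat set) set \<Rightarrow> nat set \<Rightarrow> (nat \<Rightarrow> nat) \<Rightarrow> (nat \<Rightarrow> complex) \<Rightarrow> complex" where
  "bo_term q X I i t = monom_part I i t * lim (\<lambda>L. \<Prod>l<L. fac q X t (Suc l) (low I i (Suc l)))"

definition bo_sum :: "complex \<Rightarrow> (nat \<times> nat set) set \<Rightarrow> nat set \<Rightarrow> (nat \<Rightarrow> nat) set \<Rightarrow> (nat \<Rightarrow> complex) \<Rightarrow> complex" where
  "bo_sum q X I A t = (\<Sum>\<^sub>\<infinity>i\<in>A. bo_term q X I i t)"

lemma norm_mon: "norm (mon q t l S) = norm q ^ l * (\<Prod>j\<in>S. norm (t j) ^ 2)"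
  by (simp add: mon_def norm_mult norm_power prod_norm[symmetric])

lemma prod_norm_square_mono:
  assumes "finite I" "S \<subseteq> I" "\<And>j. j \<in> I \<Longrightarrow> 1 \<le> norm (t j :: complex)"
  shows "(\<Prod>j\<in>S. norm (t j) ^ 2) \<le> (\<Prod>j\<in>I. norm (t j) ^ 2)"
  using assms by (intro prod_mono2) (auto simp: one_le_power)

lemma odd_power: "(c::real) ^ (2 * a + 1) = c ^ 1 * (c\<^sup>2) ^ a"
  by (simp add: power_mult)

text \<open>The absolute value keeps the factors nonnegative for indices outside \<open>I\<close>
  too, as the product criterion demands.\<close>

lemma summable_monom_part_bound:
  fixes rho :: "nat \<Rightarrow> real"
  assumes I: "finite I" and rho: "\<And>j. j \<in> I \<Longrightarrow> 1 < rho j"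
  shows "(\<lambda>i. \<Prod>j\<in>I. (1 / \<bar>rho j\<bar>) ^ (2 * i j + 1)) summable_on (I \<rightarrow>\<^sub>E UNIV)"
proof (rule summable_on_prod_PiE[OF I])
  fix j assume j: "j \<in> I"
  have "(1 / rho j) ^ 2 < 1" using rho[OF j] by (simp add: power_less_one_iff)
  then have "summable (\<lambda>a. (1 / \<bar>rho j\<bar>) ^ 1 * ((1 / \<bar>rho j\<bar>) ^ 2) ^ a)"
    using rho[OF j] by (intro summable_mult summable_geometric) auto
  then have "summable (\<lambda>a. (1 / \<bar>rho j\<bar>) ^ (2 * a + 1))"
    by (simp only: odd_power)
  then show "(\<lambda>a. (1 / \<bar>rho j\<bar>) ^ (2 * a + 1)) summable_on UNIV"
    by (rule summable_nonneg_imp_summable_on) auto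
qed auto

lemma norm_powi_odd:
  fixes s :: complex
  shows "norm (s powi (- 2 * int a - 1)) = (1 / norm s) ^ (2 * a + 1)"
proof -
  have "- 2 * int a - 1 = - int (2 * a + 1)" by simp
  then have "s powi (- 2 * int a - 1) = inverse (s ^ (2 * a + 1))"
    by (metis power_int_minus power_int_of_nat)
  then show ?thesis
    by (simp only: norm_inverse norm_power power_one_over inverse_eq_divide norm_divide norm_one)
qed

lemma norm_monom_part:
  "norm (monom_part I i t) = (\<Prod>j\<in>I. (1 / norm (t j)) ^ (2 * i j + 1))"
  by (simp only: monom_part_def prod_norm[symmetric] norm_powi_odd)

text \<open>The part of the expanded summand that depends on \<open>lam\<close>, once coordinate
  \<open>j\<close> has been assigned to row \<open>i j\<close> and the fixed powers in
  \<open>monom_part\<close> have been split off.\<close>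

definition pweight :: "complex \<Rightarrow> nat set \<Rightarrow> (nat \<Rightarrow> nat) \<Rightarrow> (nat \<Rightarrow> complex) \<Rightarrow> (nat \<Rightarrow> nat) \<Rightarrow> complex" where
  "pweight q I i t lam = q ^ psize lam * (\<Prod>j\<in>I. (t j)\<^sup>2 ^ lam (i j))"

text \<open>A column of height \<open>L + 1\<close> adds one box to each of the rows
  \<open>0, ..., L\<close>: the size grows by \<open>L + 1\<close>, and \<open>lam (i j)\<close> by
  one exactly when \<open>i j < L + 1\<close>.\<close>

lemma pweight_add_col:
  assumes "finite I" "mu \<in> plen L"
  shows "pweight q I i t (add_col L (mu, a)) = pweight q I i t mu * mon q t (Suc L) (low I i (Suc L)) ^ a"
proof -
  have "psize (add_col L (mu, a)) = psize mu + Suc L * a"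
  proof -
    have "(\<Sum>j<Suc L. add_col L (mu, a) j) = (\<Sum>j<Suc L. mu j + a)"
      by (intro sum.cong) (auto simp: add_col_def)
    then show ?thesis
      using psize_plen[OF add_col_plen[OF assms(2)], of a] psize_plen[of mu "Suc L"] plen_mono[of L "Suc L"] assms(2)
      by (auto simp: sum.distrib)
  qed
  moreover have "(\<Prod>j\<in>I. (t j)\<^sup>2 ^ add_col L (mu, a) (i j)) = (\<Prod>j\<in>I. (t j)\<^sup>2 ^ mu (i j)) * (\<Prod>j\<in>low I i (Suc L). (t j)\<^sup>2) ^ a"
  proof -
    have "(\<Prod>j\<in>I. (t j)\<^sup>2 ^ add_col L (mu, a) (i j)) = (\<Prod>j\<in>I. (t j)\<^sup>2 ^ mu (i j) * (if i j < Suc L then (t j)\<^sup>2 ^ a else 1))"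
      by (intro prod.cong) (auto simp: add_col_def power_add)
    also have "\<dots> = (\<Prod>j\<in>I. (t j)\<^sup>2 ^ mu (i j)) * (\<Prod>j\<in>low I i (Suc L). (t j)\<^sup>2 ^ a)"
      using assms(1) by (simp add: prod.distrib prod.inter_filter low_def)
    finally show ?thesis by (simp add: prod_power_distrib)
  qed
  ultimately show ?thesis
    by (simp add: pweight_def mon_def power_add power_mult_distrib power_mult[symmetric] mult_ac)
qed

text \<open>Write \<open>1 / (1 - y) = 1 + y / (1 - y)\<close> and bound the product by the
  exponential of a geometric sum. Only \<open>c\<close> and \<open>P\<close> enter the bound, which
  makes it uniform over all row assignments.\<close>

lemma prod_geometric_bound:
  fixes y :: "nat \<Rightarrow> real"
  assumes c: "0 \<le> c" "c < 1" and P: "0 \<le> P" "c * P < 1"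
    and y: "\<And>l. 0 \<le> y l" "\<And>l. y l \<le> c ^ Suc l * P"
  shows "(\<Prod>l<L. 1 / (1 - y l)) \<le> exp (P / (1 - c * P) / (1 - c))"
proof -
  have yle: "y l \<le> c * P" for l
  proof -
    have "c ^ Suc l * P \<le> c * P" using c P by (intro mult_right_mono) (auto simp: mult_left_le power_le_one)
    then show ?thesis using y(2)[of l] by simp
  qed
  have "1 / (1 - y l) \<le> 1 + c ^ l * (P / (1 - c * P))" for l
  proof -
    have "1 / (1 - y l) = 1 + y l / (1 - y l)" using yle[of l] P(2) by (simp add: field_simps)
    also have "y l / (1 - y l) \<le> (c ^ l * P) / (1 - c * P)"
    proof (rule frac_le)
      have "c ^ Suc l * P \<le> c ^ l * P" using c P by (intro mult_right_mono) (auto simp: mult_left_le_one_le)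
      then show "y l \<le> c ^ l * P" using y(2)[of l] by simp
    qed (use yle[of l] P c y in auto)
    finally show ?thesis by simp
  qed
  then have "(\<Prod>l<L. 1 / (1 - y l)) \<le> (\<Prod>l<L. 1 + c ^ l * (P / (1 - c * P)))"
    using yle P(2) by (intro prod_mono) (auto intro: less_imp_le order.strict_trans1)
  also have "\<dots> \<le> exp (\<Sum>l<L. c ^ l * (P / (1 - c * P)))"
    using c P by (intro prod_le_exp_sum) auto
  also have "(\<Sum>l<L. c ^ l * (P / (1 - c * P))) \<le> (\<Sum>l. c ^ l) * (P / (1 - c * P))"
    unfolding sum_distrib_right[symmetric] using c P
    by (intro mult_right_mono sum_le_suminf summable_geometric) auto
  also have "\<dots> = P / (1 - c * P) / (1 - c)"
    using c by (simp add: suminf_geometric)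
  finally show ?thesis by simp
qed

text \<open>\<open>conv_region\<close> makes the largest of all the monomials, the one with
  \<open>l = 1\<close> and all of \<open>I\<close>, smaller than 1 in norm; raising \<open>l\<close>
  or shrinking the set only decreases it. The bound \<open>C\<close> is independent of
  \<open>i\<close>.\<close>

lemma pweight_has_sum:
  assumes I: "finite I" and q: "norm q < 1" and t: "t \<in> conv_region q I"
  defines "P \<equiv> \<Prod>j\<in>I. norm (t j) ^ 2"
  defines "C \<equiv> exp (P / (1 - norm q * P) / (1 - norm q))"
  shows "(\<lambda>lam. norm (pweight q I i t lam)) summable_on partitions"
    and "(\<Sum>\<^sub>\<infinity>lam\<in>partitions. norm (pweight q I i t lam)) \<le> C"
    and "(\<Sum>\<^sub>\<infinity>lam\<in>partitions. pweight q I i t lam) = lim (\<lambda>L. \<Prod>l<L. fac q {} t (Suc l) (low I i (Suc l)))"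
proof -
  have P: "norm q * P < 1" and t1: "\<And>j. j \<in> I \<Longrightarrow> 1 < norm (t j)"
    using t by (auto simp: conv_region_def region_def P_def)
  have P0: "0 \<le> P" unfolding P_def by (intro prod_nonneg) auto
  define x where "x l = mon q t (Suc l) (low I i (Suc l))" for l
  have nx: "norm (x l) \<le> norm q ^ Suc l * P" for l
    unfolding x_def norm_mon P_def using I t1
    by (intro mult_left_mono prod_norm_square_mono) (auto simp: low_def less_imp_le)
  have x1: "norm (x l) < 1" for l
  proof -
    have "norm q ^ Suc l * P \<le> norm q * P"
      using q P0 by (intro mult_right_mono) (auto simp: mult_left_le power_le_one)
    then show ?thesis using nx[of l] P by linarith
  qed
  have C: "(\<Prod>l<L. 1 / (1 - norm (x l))) \<le> C" for L
    unfolding C_def by (rule prod_geometric_bound) (use q P P0 nx in auto)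
  have w0: "pweight q I i t (\<lambda>_. 0) = 1" by (simp add: pweight_def psize_def)
  note ps = partitions_has_sum[of "pweight q I i t" x C, OF w0 _ x1 C]
  have st: "\<And>L mu a. mu \<in> plen L \<Longrightarrow> pweight q I i t (add_col L (mu, a)) = pweight q I i t mu * x L ^ a"
    unfolding x_def using pweight_add_col[OF I] by blast
  show "(\<lambda>lam. norm (pweight q I i t lam)) summable_on partitions"
    and "(\<Sum>\<^sub>\<infinity>lam\<in>partitions. norm (pweight q I i t lam)) \<le> C"
    using ps(1,2)[OF st] by auto
  show "(\<Sum>\<^sub>\<infinity>lam\<in>partitions. pweight q I i t lam) = lim (\<lambda>L. \<Prod>l<L. fac q {} t (Suc l) (low I i (Suc l)))"
    using limI[OF ps(3)[OF st]] by (simp add: fac_def x_def)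
qed

lemma powi_shift:
  fixes s :: complex
  assumes "s \<noteq> 0"
  shows "s powi (2 * int a - 2 * int b - 1) = s powi (- 2 * int b - 1) * (s\<^sup>2) ^ a"
proof -
  have "2 * int a - 2 * int b - 1 = (- 2 * int b - 1) + int (2 * a)" by simp
  then show ?thesis using assms by (metis power_int_add power_int_of_nat power_mult)
qed

lemma inner_sum_infsum:
  assumes s: "1 < norm s" and lam: "lam \<in> partitions"
  shows "(\<lambda>j. norm (s powi (2 * int (lam j) - 2 * int j - 1))) summable_on UNIV"
    and "inner_sum s lam = (\<Sum>\<^sub>\<infinity>j. s powi (2 * int (lam j) - 2 * int j - 1))"
proof -
  have s0: "s \<noteq> 0" using s by auto
  have bd: "norm (s powi (2 * int (lam j) - 2 * int j - 1)) \<le> norm s ^ (2 * lam 0) * (1 / norm s) ^ (2 * j + 1)" for j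
  proof -
    have "norm ((s\<^sup>2) ^ lam j) \<le> norm s ^ (2 * lam 0)"
      using s lam by (auto simp: norm_power power_mult[symmetric] partitions_def intro!: power_increasing)
    then show ?thesis
      unfolding powi_shift[OF s0] norm_mult norm_powi_odd by (subst mult.commute) (intro mult_right_mono, auto)
  qed
  have "1 / norm s < 1" using s by (simp add: divide_less_eq)
  then have "(1 / norm s) ^ 2 < 1" by (simp add: power_less_one_iff)
  then have "summable (\<lambda>j. norm s ^ (2 * lam 0) * ((1 / norm s) ^ 1 * ((1 / norm s) ^ 2) ^ j))"
    by (intro summable_mult summable_geometric) auto
  then have "summable (\<lambda>j. norm s ^ (2 * lam 0) * (1 / norm s) ^ (2 * j + 1))"
    by (simp only: odd_power)
  then have sm: "summable (\<lambda>j. norm (s powi (2 * int (lam j) - 2 * int j - 1)))"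
    by (rule summable_comparison_test') (use bd in auto)
  then show "(\<lambda>j. norm (s powi (2 * int (lam j) - 2 * int j - 1))) summable_on UNIV"
    by (rule summable_nonneg_imp_summable_on) auto
  show "inner_sum s lam = (\<Sum>\<^sub>\<infinity>j. s powi (2 * int (lam j) - 2 * int j - 1))"
    unfolding inner_sum_def
    by (rule infsumI[symmetric], rule norm_summable_imp_has_sum[OF sm], rule summable_sums, rule summable_norm_cancel[OF sm])
qed

text \<open>The sums over row assignments and over partitions may be exchanged: for fixed
  \<open>i\<close> the norms of the partition weights add up to at most \<open>C\<close>, uniformly
  in \<open>i\<close>, and the norms of the \<open>monom_part\<close> are summable over
  \<open>i\<close>.\<close>

lemma numerator_eq_bo_sum:
  assumes I: "finite I" and q: "norm q < 1" and t: "t \<in> conv_region q I"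
  shows "(\<Sum>\<^sub>\<infinity>lam\<in>partitions. q ^ psize lam * (\<Prod>k\<in>I. inner_sum (t k) lam)) = bo_sum q {} I (I \<rightarrow>\<^sub>E UNIV) t"
proof -
  define P where "P = (\<Prod>j\<in>I. norm (t j) ^ 2)"
  define C where "C = exp (P / (1 - norm q * P) / (1 - norm q))"
  note pw = pweight_has_sum[OF I q t, folded P_def, folded C_def]
  have t1: "1 < norm (t j)" if "j \<in> I" for j using t that by (auto simp: conv_region_def region_def)
  define f where "f = (\<lambda>(i, lam). monom_part I i t * pweight q I i t lam)"
  have "(\<lambda>p. norm (f p)) summable_on (I \<rightarrow>\<^sub>E UNIV) \<times> partitions"
  proof (subst Infinite_Sum.abs_summable_on_Sigma_iff, intro conjI ballI)
    fix i show "(\<lambda>lam. norm (f (i, lam))) summable_on partitions"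
      unfolding f_def using pw(1)[of i] by (auto simp: norm_mult intro: summable_on_cmult_right)
  next
    have "(\<lambda>i. (\<Prod>j\<in>I. (1 / \<bar>norm (t j)\<bar>) ^ (2 * i j + 1)) * C) summable_on (I \<rightarrow>\<^sub>E UNIV)"
      by (intro summable_on_cmult_left summable_monom_part_bound I t1)
    then have sm: "(\<lambda>i. norm (monom_part I i t) * C) summable_on (I \<rightarrow>\<^sub>E UNIV)"
      by (simp only: norm_monom_part abs_norm_cancel)
    have "norm (\<Sum>\<^sub>\<infinity>lam\<in>partitions. norm (f (i, lam))) \<le> norm (monom_part I i t) * C" for i
      unfolding f_def using pw(2)[of i]
      by (simp add: norm_mult infsum_cmult_right' infsum_nonneg mult_left_mono)
    then show "(\<lambda>i. norm (\<Sum>\<^sub>\<infinity>lam\<in>partitions. norm (f (i, lam)))) summable_on (I \<rightarrow>\<^sub>E UNIV)"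
      by (intro summable_on_comparison_test[OF sm]) auto
  qed
  then have sumf: "f summable_on (I \<rightarrow>\<^sub>E UNIV) \<times> partitions"
    by (rule abs_summable_summable)
  have "q ^ psize lam * (\<Prod>k\<in>I. inner_sum (t k) lam) = (\<Sum>\<^sub>\<infinity>i\<in>I \<rightarrow>\<^sub>E UNIV. f (i, lam))" if lam: "lam \<in> partitions" for lam
  proof -
    have "(\<Prod>k\<in>I. inner_sum (t k) lam) = (\<Prod>k\<in>I. \<Sum>\<^sub>\<infinity>j. t k powi (2 * int (lam j) - 2 * int j - 1))"
      using inner_sum_infsum(2)[OF t1 lam] by (intro prod.cong) auto
    also have "\<dots> = (\<Sum>\<^sub>\<infinity>i\<in>I \<rightarrow>\<^sub>E UNIV. \<Prod>k\<in>I. t k powi (2 * int (lam (i k)) - 2 * int (i k) - 1))"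
      using inner_sum_infsum(1)[OF t1 lam] by (intro infsum_prod_PiE_abs[symmetric] I) auto
    also have "\<dots> = (\<Sum>\<^sub>\<infinity>i\<in>I \<rightarrow>\<^sub>E UNIV. monom_part I i t * (\<Prod>k\<in>I. (t k)\<^sup>2 ^ lam (i k)))"
    proof (intro infsum_cong)
      fix i
      have "t k \<noteq> 0" if "k \<in> I" for k using t1[OF that] by auto
      then show "(\<Prod>k\<in>I. t k powi (2 * int (lam (i k)) - 2 * int (i k) - 1)) = monom_part I i t * (\<Prod>k\<in>I. (t k)\<^sup>2 ^ lam (i k))"
        unfolding monom_part_def prod.distrib[symmetric] by (intro prod.cong refl powi_shift) auto
    qed
    finally show ?thesis
      by (simp add: f_def pweight_def infsum_cmult_right'[symmetric] mult_ac)
  qed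
  then have "(\<Sum>\<^sub>\<infinity>lam\<in>partitions. q ^ psize lam * (\<Prod>k\<in>I. inner_sum (t k) lam)) = (\<Sum>\<^sub>\<infinity>lam\<in>partitions. \<Sum>\<^sub>\<infinity>i\<in>I \<rightarrow>\<^sub>E UNIV. f (i, lam))"
    by (intro infsum_cong) auto
  also have "\<dots> = (\<Sum>\<^sub>\<infinity>i\<in>I \<rightarrow>\<^sub>E UNIV. \<Sum>\<^sub>\<infinity>lam\<in>partitions. f (i, lam))"
    by (rule infsum_swap_banach[symmetric, where f = "\<lambda>i lam. f (i, lam)"]) (use sumf in \<open>simp add: case_prod_eta\<close>)
  also have "\<dots> = bo_sum q {} I (I \<rightarrow>\<^sub>E UNIV) t"
    unfolding bo_sum_def by (intro infsum_cong) (simp add: f_def bo_term_def infsum_cmult_right' pw(3))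
  finally show ?thesis .
qed

subsection \<open>Local uniform convergence\<close>

lemma continuous_on_coord [continuous_intros]:
  "continuous_on A (\<lambda>t::nat \<Rightarrow> complex. t j)"
  by (rule continuous_on_subset[OF continuous_on_product_coordinates]) auto

lemma continuous_on_mon [continuous_intros]: "continuous_on A (\<lambda>t. mon q t l S)"
  unfolding mon_def by (intro continuous_intros)

lemma continuous_on_fun_upd: "continuous_on A (\<lambda>z::complex. (t :: nat \<Rightarrow> complex)(j := z))"
proof (rule continuous_on_coordinatewise_then_product)
  fix i show "continuous_on A (\<lambda>z. (t(j := z)) i)" by (cases "i = j") auto
qed

lemma open_fun_upd_vimage:
  assumes "open (V :: (nat \<Rightarrow> complex) set)"
  shows "open {z. t(j := z) \<in> V}"
  using open_vimage[OF assms continuous_on_fun_upd[of UNIV t j]] by (simp add: vimage_def)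

lemma holomorphic_on_coord [holomorphic_intros]: "(\<lambda>z. ((t :: nat \<Rightarrow> complex)(j := z)) k) holomorphic_on W"
  by (cases "k = j") (auto intro: holomorphic_intros)

text \<open>Near \<open>t0\<close> the monomials are below 1/2 in norm for all large
  \<open>l\<close>, so only finitely many pairs \<open>(l, S)\<close> can bring a denominator near
  0, and each of these is controlled by an open condition.\<close>

lemma local_bounds:
  assumes I: "finite I" and q: "norm q < 1" and t0: "t0 \<in> region I"
    and gen: "\<And>l S. 1 \<le> l \<Longrightarrow> S \<subseteq> I \<Longrightarrow> (l, S) \<notin> X \<Longrightarrow> mon q t0 l S \<noteq> 1"
  obtains V d rho B where "open V" "t0 \<in> V" "V \<subseteq> region I" "d > 0" "rho > 1" "B \<ge> 0"
    "\<And>t j. t \<in> V \<Longrightarrow> j \<in> I \<Longrightarrow> rho \<le> norm (t j)"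
    "\<And>t. t \<in> V \<Longrightarrow> (\<Prod>j\<in>I. norm (t j) ^ 2) \<le> B"
    "\<And>t l S. t \<in> V \<Longrightarrow> 1 \<le> l \<Longrightarrow> S \<subseteq> I \<Longrightarrow> (l, S) \<notin> X \<Longrightarrow> d \<le> norm (1 - mon q t l S)"
proof -
  \<comment> \<open>Midpoints between 1 and \<open>norm (t0 j)\<close>; the inserted 2 keeps
    \<open>Min\<close> meaningful for empty \<open>I\<close>.\<close>
  define rho where "rho = Min (insert 2 ((\<lambda>j. (1 + norm (t0 j)) / 2) ` I))"
  have rho1: "rho > 1" unfolding rho_def using I t0 by (subst Min_gr_iff) (auto simp: region_def)
  have rho_lt: "rho < norm (t0 j)" if "j \<in> I" for j
  proof -
    have "rho \<le> (1 + norm (t0 j)) / 2" unfolding rho_def using I that by (intro Min_le) auto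
    moreover have "1 < norm (t0 j)" using t0 that by (auto simp: region_def)
    ultimately show ?thesis by argo
  qed
  define B where "B = (\<Prod>j\<in>I. norm (t0 j) ^ 2) + 1"
  have B: "B \<ge> 1" unfolding B_def by (simp add: prod_nonneg)
  have "(\<lambda>l. norm q ^ l * B) \<longlonglongrightarrow> 0 * B"
    using q by (intro tendsto_intros LIMSEQ_power_zero) auto
  then have "\<forall>\<^sub>F l in sequentially. norm q ^ l * B < 1 / 2"
    by (rule order_tendstoD) auto
  then obtain L0 where L0: "\<And>l. l \<ge> L0 \<Longrightarrow> norm q ^ l * B < 1 / 2"
    by (auto simp: eventually_sequentially)
  define Q where "Q = {(l, S). 1 \<le> l \<and> l < L0 \<and> S \<subseteq> I \<and> (l, S) \<notin> X}"
  have finQ: "finite Q"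
    by (rule finite_subset[of _ "{..<L0} \<times> Pow I"]) (use I in \<open>auto simp: Q_def\<close>)
  \<comment> \<open>The inserted 1/2 is the bound for the heights \<open>l \<ge> L0\<close>, where
    the monomial has norm below 1/2.\<close>
  define d where "d = Min (insert (1 / 2) ((\<lambda>(l, S). norm (1 - mon q t0 l S) / 2) ` Q))"
  have d0: "d > 0" unfolding d_def using finQ gen by (subst Min_gr_iff) (force simp: Q_def)+
  have d_half: "d \<le> 1 / 2" unfolding d_def using finQ by (intro Min_le) auto
  have d_lt: "d < norm (1 - mon q t0 l S)" if "(l, S) \<in> Q" for l S
  proof -
    have "d \<le> norm (1 - mon q t0 l S) / 2" unfolding d_def using finQ that by (intro Min_le) auto
    then show ?thesis using d0 by argo
  qed
  define V where "V = (\<Inter>j\<in>I. {t :: nat \<Rightarrow> complex. rho < norm (t j)}) \<inter> {t. (\<Prod>j\<in>I. norm (t j) ^ 2) < B}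
     \<inter> (\<Inter>p\<in>Q. {t. d < norm (1 - mon q t (fst p) (snd p))})"
  show ?thesis
  proof (rule that[of V d rho B])
    show "open V" unfolding V_def
      by (intro open_Int open_INT I finQ ballI open_Collect_less continuous_intros)
    show "t0 \<in> V" using rho_lt d_lt by (auto simp: V_def B_def)
    show "V \<subseteq> region I" using rho1 by (force simp: V_def region_def)
    show "rho \<le> norm (t j)" if "t \<in> V" "j \<in> I" for t j using that by (auto simp: V_def less_imp_le)
    show PB: "(\<Prod>j\<in>I. norm (t j) ^ 2) \<le> B" if "t \<in> V" for t using that by (auto simp: V_def)
    show "d \<le> norm (1 - mon q t l S)" if t: "t \<in> V" and l: "1 \<le> l" and S: "S \<subseteq> I" "(l, S) \<notin> X" for t l S
    proof (cases "l < L0")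
      case True
      then have "(l, S) \<in> Q" using l S by (auto simp: Q_def)
      then show ?thesis using t by (force simp: V_def)
    next
      case False
      have "(\<Prod>j\<in>S. norm (t j) ^ 2) \<le> (\<Prod>j\<in>I. norm (t j) ^ 2)"
        using t rho1 by (intro prod_norm_square_mono I S) (auto simp: V_def intro: less_imp_le order.strict_trans)
      then have "norm (mon q t l S) \<le> norm q ^ l * B"
        unfolding norm_mon using PB[OF t] by (intro mult_left_mono) auto
      then have "norm (mon q t l S) < 1 / 2" using L0[of l] False by simp
      moreover have "1 - norm (mon q t l S) \<le> norm (1 - mon q t l S)"
        using norm_triangle_ineq2[of 1 "mon q t l S"] by simp
      ultimately show ?thesis using d_half by linarith
    qed
  qed (use d0 rho1 B in auto)
qed

text \<open>Telescoping turns the product into the series of its increments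
  \<open>(\<Prod>k<l. y k t) * (y l t - 1)\<close>. The partial products are bounded by
  \<open>exp (suminf M)\<close>, so the Weierstrass test applies.\<close>

lemma uniform_limit_prod:
  fixes y :: "nat \<Rightarrow> 'b \<Rightarrow> complex"
  assumes y: "\<And>l t. t \<in> V \<Longrightarrow> norm (y l t - 1) \<le> M l" and M: "summable M" "\<And>l. 0 \<le> M l"
  shows "uniform_limit V (\<lambda>L t. \<Prod>l<L. y l t) (\<lambda>t. lim (\<lambda>L. \<Prod>l<L. y l t)) sequentially"
    and "t \<in> V \<Longrightarrow> norm (lim (\<lambda>L. \<Prod>l<L. y l t)) \<le> exp (suminf M)"
proof -
  have bd: "norm (\<Prod>l<L. y l t) \<le> exp (suminf M)" if "t \<in> V" for L t
  proof -
    have "norm (y l t) \<le> 1 + M l" for l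
      using norm_triangle_ineq[of 1 "y l t - 1"] y[OF that, of l] by simp
    then have "norm (\<Prod>l<L. y l t) \<le> (\<Prod>l<L. 1 + M l)"
      unfolding prod_norm[symmetric] by (intro prod_mono) auto
    also have "\<dots> \<le> exp (\<Sum>l<L. M l)" using M by (intro prod_le_exp_sum) auto
    also have "\<dots> \<le> exp (suminf M)" using M by (auto intro: sum_le_suminf)
    finally show ?thesis .
  qed
  have tel: "(\<Prod>l<L. y l t) = 1 + (\<Sum>l<L. (\<Prod>k<l. y k t) * (y l t - 1))" for L t
    by (induction L) (auto simp: algebra_simps)
  have telf: "(\<lambda>L t. \<Prod>l<L. y l t) = (\<lambda>L t. 1 + (\<Sum>l<L. (\<Prod>k<l. y k t) * (y l t - 1)))"
    by (intro ext tel)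
  have "uniform_limit V (\<lambda>L t. \<Sum>l<L. (\<Prod>k<l. y k t) * (y l t - 1)) (\<lambda>t. \<Sum>l. (\<Prod>k<l. y k t) * (y l t - 1)) sequentially"
  proof (rule Weierstrass_m_test)
    show "norm ((\<Prod>k<l. y k t) * (y l t - 1)) \<le> exp (suminf M) * M l" if "t \<in> V" for l t
      unfolding norm_mult using bd y that by (intro mult_mono) auto
    show "summable (\<lambda>l. exp (suminf M) * M l)" using M by (intro summable_mult)
  qed
  then have ul: "uniform_limit V (\<lambda>L t. \<Prod>l<L. y l t) (\<lambda>t. 1 + (\<Sum>l. (\<Prod>k<l. y k t) * (y l t - 1))) sequentially"
    unfolding telf by (rule uniform_limit_add[OF uniform_limit_const])
  have lim: "(\<lambda>L. \<Prod>l<L. y l t) \<longlonglongrightarrow> lim (\<lambda>L. \<Prod>l<L. y l t)"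
     "lim (\<lambda>L. \<Prod>l<L. y l t) = 1 + (\<Sum>l. (\<Prod>k<l. y k t) * (y l t - 1))" if "t \<in> V" for t
    using tendsto_uniform_limitI[OF ul that] limI by fastforce+
  show "uniform_limit V (\<lambda>L t. \<Prod>l<L. y l t) (\<lambda>t. lim (\<lambda>L. \<Prod>l<L. y l t)) sequentially"
    using ul lim(2) by (subst uniform_limit_cong'[where g = "\<lambda>L t. \<Prod>l<L. y l t"]) auto
  show "norm (lim (\<lambda>L. \<Prod>l<L. y l t)) \<le> exp (suminf M)" if "t \<in> V"
    by (rule tendsto_upperbound[OF tendsto_norm[OF lim(1)[OF that]]]) (use bd that in auto)
qed

lemma holomorphic_on_uniform_limit:
  assumes W: "open W" and hol: "\<forall>\<^sub>F n in F. f n holomorphic_on W" and lim: "uniform_limit W f g F" and F: "F \<noteq> bot"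
  shows "g holomorphic_on W"
proof -
  have "g field_differentiable (at z)" if "z \<in> W" for z
  proof -
    obtain e where e: "e > 0" "cball z e \<subseteq> W" using W \<open>z \<in> W\<close> open_contains_cball by blast
    have "g holomorphic_on ball z e"
    proof (rule holomorphic_uniform_limit)
      show "\<forall>\<^sub>F n in F. continuous_on (cball z e) (f n) \<and> f n holomorphic_on ball z e"
        using hol
      proof (rule eventually_mono)
        fix n assume "f n holomorphic_on W"
        then have "f n holomorphic_on cball z e" using e by (auto intro: holomorphic_on_subset)
        then show "continuous_on (cball z e) (f n) \<and> f n holomorphic_on ball z e"
          using ball_subset_cball by (blast intro: holomorphic_on_imp_continuous_on holomorphic_on_subset)
      qed
      show "uniform_limit (cball z e) f g F" by (rule uniform_limit_on_subset[OF lim e(2)])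
    qed (use F in auto)
    then show ?thesis using e by (auto intro!: holomorphic_on_imp_differentiable_at[of g "ball z e"])
  qed
  then show ?thesis by (auto simp: holomorphic_on_def intro: field_differentiable_at_within)
qed

lemma uniform_limit_substitute:
  assumes "uniform_limit V f g F" "\<And>z. z \<in> W \<Longrightarrow> h z \<in> V"
  shows "uniform_limit W (\<lambda>n z. f n (h z)) (\<lambda>z. g (h z)) F"
  using assms unfolding uniform_limit_iff by (fast elim: eventually_mono)

text \<open>The majorants depend neither on \<open>t\<close> in \<open>V\<close> nor, for the
  products, on \<open>i\<close>, so one neighbourhood serves all terms. Factors listed in
  \<open>X\<close> are replaced by 1, so \<open>V\<close> may cross their divisors. The set
  \<open>A\<close> is arbitrary so that the singular and the regular terms can be summed
  separately.\<close>

lemma bo_sum_regular: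
  assumes I: "finite I" and q: "norm q < 1" and t0: "t0 \<in> region I"
    and gen: "\<And>l S. 1 \<le> l \<Longrightarrow> S \<subseteq> I \<Longrightarrow> (l, S) \<notin> X \<Longrightarrow> mon q t0 l S \<noteq> 1"
  obtains V where "open V" "t0 \<in> V" "V \<subseteq> region I"
    "\<And>t l S. t \<in> V \<Longrightarrow> 1 \<le> l \<Longrightarrow> S \<subseteq> I \<Longrightarrow> (l, S) \<notin> X \<Longrightarrow> mon q t l S \<noteq> 1"
    "\<And>t i. t \<in> V \<Longrightarrow> (\<lambda>L. \<Prod>l<L. fac q X t (Suc l) (low I i (Suc l)))
         \<longlonglongrightarrow> lim (\<lambda>L. \<Prod>l<L. fac q X t (Suc l) (low I i (Suc l)))"
    "\<And>t. t \<in> V \<Longrightarrow> (\<lambda>i. bo_term q X I i t) summable_on (I \<rightarrow>\<^sub>E UNIV)"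
    "\<And>A t j. A \<subseteq> I \<rightarrow>\<^sub>E UNIV \<Longrightarrow> (\<lambda>z. bo_sum q X I A (t(j := z))) holomorphic_on {z. t(j := z) \<in> V}"
proof -
  obtain V d rho B where V: "open V" "t0 \<in> V" "V \<subseteq> region I" and d: "d > 0" and rho: "rho > 1" and B: "B \<ge> 0"
    and rho': "\<And>t j. t \<in> V \<Longrightarrow> j \<in> I \<Longrightarrow> rho \<le> norm (t j)"
    and B': "\<And>t. t \<in> V \<Longrightarrow> (\<Prod>j\<in>I. norm (t j) ^ 2) \<le> B"
    and d': "\<And>t l S. t \<in> V \<Longrightarrow> 1 \<le> l \<Longrightarrow> S \<subseteq> I \<Longrightarrow> (l, S) \<notin> X \<Longrightarrow> d \<le> norm (1 - mon q t l S)"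
    by (rule local_bounds[of I q t0 X, OF I q t0]) (erule (2) gen, (rule that; assumption))
  define M where "M l = norm q ^ Suc l * (B / d)" for l
  have M: "summable M" "\<And>l. 0 \<le> M l"
  proof -
    show "summable M" unfolding M_def
      using summable_mult2[OF summable_mult[OF summable_geometric[of "norm q"], of "norm q"]] q by simp
  qed (use B d in \<open>auto simp: M_def\<close>)
  have tnz: "t j \<noteq> 0" if "t \<in> V" "j \<in> I" for t j using rho' rho that by fastforce
  have lowI: "low I i l \<subseteq> I" for i l by (auto simp: low_def)
  have ne1: "mon q t l S \<noteq> 1" if "t \<in> V" "1 \<le> l" "S \<subseteq> I" "(l, S) \<notin> X" for t l S
    using d'[OF that] d by auto
  have fac_bd: "norm (fac q X t (Suc l) (low I i (Suc l)) - 1) \<le> M l" if t: "t \<in> V" for t l i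
  proof (cases "(Suc l, low I i (Suc l)) \<in> X")
    case True
    then show ?thesis using M by (simp add: fac_def)
  next
    case False
    let ?x = "mon q t (Suc l) (low I i (Suc l))"
    have "norm ?x \<le> norm q ^ Suc l * (\<Prod>j\<in>I. norm (t j) ^ 2)"
      unfolding norm_mon using rho rho'[OF t] by (intro mult_left_mono prod_norm_square_mono I lowI) (auto intro: order.trans[OF less_imp_le])
    also have "\<dots> \<le> norm q ^ Suc l * B" using B'[OF t] by (intro mult_left_mono) auto
    finally have x: "norm ?x \<le> norm q ^ Suc l * B" .
    have "fac q X t (Suc l) (low I i (Suc l)) - 1 = ?x / (1 - ?x)"
      using False ne1[OF t _ lowI] by (simp add: fac_def field_simps)
    also have "norm \<dots> \<le> (norm q ^ Suc l * B) / d"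
      unfolding norm_divide using x d d'[OF t _ lowI False] B by (intro frac_le) auto
    finally show ?thesis by (simp add: M_def)
  qed
  have ul1: "uniform_limit V (\<lambda>L t. \<Prod>l<L. fac q X t (Suc l) (low I i (Suc l)))
      (\<lambda>t. lim (\<lambda>L. \<Prod>l<L. fac q X t (Suc l) (low I i (Suc l)))) sequentially" for i
    by (rule uniform_limit_prod(1)[OF _ M]) (rule fac_bd)
  have ul2: "norm (lim (\<lambda>L. \<Prod>l<L. fac q X t (Suc l) (low I i (Suc l)))) \<le> exp (suminf M)" if "t \<in> V" for t i
    by (rule uniform_limit_prod(2)[where V = V, OF _ M that]) (rule fac_bd)
  define N where "N i = (\<Prod>j\<in>I. (1 / \<bar>rho\<bar>) ^ (2 * i j + 1)) * exp (suminf M)" for i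
  have Nsum: "N summable_on (I \<rightarrow>\<^sub>E UNIV)"
    unfolding N_def by (intro summable_on_cmult_left summable_monom_part_bound[where rho = "\<lambda>_. rho"] I rho)
  have term_bd: "norm (bo_term q X I i t) \<le> N i" if t: "t \<in> V" for t i
  proof -
    have "norm (monom_part I i t) \<le> (\<Prod>j\<in>I. (1 / \<bar>rho\<bar>) ^ (2 * i j + 1))"
      unfolding norm_monom_part using rho rho'[OF t]
      by (intro prod_mono conjI power_mono divide_left_mono) (auto intro!: mult_pos_pos simp: tnz[OF t])
    then show ?thesis unfolding bo_term_def N_def norm_mult using ul2[OF t, of i]
      by (intro mult_mono) (auto intro!: prod_nonneg)
  qed
  have ulE: "uniform_limit V (\<lambda>F t. \<Sum>i\<in>F. bo_term q X I i t) (bo_sum q X I A) (finite_subsets_at_top A)"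
    if A: "A \<subseteq> I \<rightarrow>\<^sub>E UNIV" for A
    unfolding bo_sum_def
    by (rule Weierstrass_m_test_general[where M = N]) (use term_bd summable_on_subset_banach[OF Nsum A] in auto)
  have fac_hol: "(\<lambda>z. fac q X (t(j := z)) (Suc l) (low I i (Suc l))) holomorphic_on {z. t(j := z) \<in> V}" for l i t j
    using ne1[OF _ _ lowI, of _ "Suc l" i "Suc l"] unfolding fac_def mon_def by (cases "(Suc l, low I i (Suc l)) \<in> X") (auto intro!: holomorphic_intros simp del: fun_upd_apply)
  have opn: "open {z. t(j := z) \<in> V}" for t j by (rule open_fun_upd_vimage[OF V(1)])
  have term_hol: "(\<lambda>z. bo_term q X I i (t(j := z))) holomorphic_on {z. t(j := z) \<in> V}" for i t j
  proof -
    have "(\<lambda>z. lim (\<lambda>L. \<Prod>l<L. fac q X (t(j := z)) (Suc l) (low I i (Suc l)))) holomorphic_on {z. t(j := z) \<in> V}"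
      by (rule holomorphic_on_uniform_limit[OF opn _ uniform_limit_substitute[OF ul1[of i], of _ "\<lambda>z. t(j := z)"]])
         (auto intro!: always_eventually holomorphic_intros fac_hol)
    moreover have "(\<lambda>z. monom_part I i (t(j := z))) holomorphic_on {z. t(j := z) \<in> V}"
      unfolding monom_part_def using tnz by (intro holomorphic_intros) (blast dest: CollectD)
    ultimately show ?thesis unfolding bo_term_def by (intro holomorphic_intros)
  qed
  show ?thesis
  proof (rule that[OF V ne1])
    show "(\<lambda>L. \<Prod>l<L. fac q X t (Suc l) (low I i (Suc l))) \<longlonglongrightarrow> lim (\<lambda>L. \<Prod>l<L. fac q X t (Suc l) (low I i (Suc l)))"
      if "t \<in> V" for t i using tendsto_uniform_limitI[OF ul1 that] .
    show "(\<lambda>i. bo_term q X I i t) summable_on (I \<rightarrow>\<^sub>E UNIV)" if "t \<in> V" for t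
      by (rule abs_summable_summable, rule summable_on_comparison_test[OF Nsum]) (use term_bd that in auto)
    show "(\<lambda>z. bo_sum q X I A (t(j := z))) holomorphic_on {z. t(j := z) \<in> V}" if "A \<subseteq> I \<rightarrow>\<^sub>E UNIV" for A t j
      by (rule holomorphic_on_uniform_limit[OF opn _ uniform_limit_substitute[OF ulE[OF that], of _ "\<lambda>z. t(j := z)"]])
         (auto intro!: holomorphic_intros term_hol always_eventually)
  qed auto
qed

subsection \<open>Analytic continuation and removal of singularities\<close>

lemma divs_iff: "t \<in> divs q I \<longleftrightarrow> (\<exists>m S. 1 \<le> m \<and> S \<subseteq> I \<and> mon q t m S = 1)"
  by (auto simp: divs_def mon_def)

lemma holo_in_slice:
  assumes "holo_in I U f" "i \<in> I"
  shows "(\<lambda>z. f (t(i := z))) holomorphic_on {z. t(i := z) \<in> U}"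
proof -
  have "(\<lambda>z. f (t(i := z))) field_differentiable (at z0)" if "t(i := z0) \<in> U" for z0
  proof -
    have "(\<lambda>z. f ((t(i := z0))(i := z))) field_differentiable (at ((t(i := z0)) i))"
      using assms that unfolding holo_in_def by blast
    then show ?thesis by simp
  qed
  then show ?thesis by (auto simp: holomorphic_on_def intro: field_differentiable_at_within)
qed

text \<open>Along the line each of the countably many monomials is either constant, and then not 1
  since \<open>t\<close> is off the divisors, or a multiple of \<open>z\<^sup>2\<close>. Removing a
  countable set does not disconnect a planar domain, which is what the identity theorem
  needs.\<close>

lemma slice_divs_countable:
  assumes I: "finite I" and t: "t \<notin> divs q I"
  shows "countable {z. t(i := z) \<in> divs q I}"
proof -
  have "finite {z. mon q (t(i := z)) m S = 1}" if "1 \<le> m" "S \<subseteq> I" for m S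
  proof (cases "i \<in> S")
    case False
    then have "(\<Prod>j\<in>S. ((t(i := z)) j)\<^sup>2) = (\<Prod>j\<in>S. (t j)\<^sup>2)" for z
      by (intro prod.cong) auto
    then have "mon q (t(i := z)) m S = mon q t m S" for z by (simp only: mon_def)
    then show ?thesis using t that by (auto simp: divs_iff)
  next
    case True
    have "finite S" using I that finite_subset by blast
    define c where "c = q ^ m * (\<Prod>j\<in>S - {i}. (t j)\<^sup>2)"
    have "mon q (t(i := z)) m S = c * z\<^sup>2" for z
      using True \<open>finite S\<close> by (simp add: mon_def c_def prod.remove)
    moreover have "{z. c * z\<^sup>2 = 1} \<subseteq> {csqrt (1 / c), - csqrt (1 / c)}"
    proof
      fix z assume "z \<in> {z. c * z\<^sup>2 = 1}"
      then have "c * z\<^sup>2 = 1" by simp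
      then have "z\<^sup>2 = (csqrt (1 / c))\<^sup>2" by (cases "c = 0") (auto simp: field_simps)
      then show "z \<in> {csqrt (1 / c), - csqrt (1 / c)}" unfolding power2_eq_iff by blast
    qed
    ultimately show ?thesis using finite_subset by fastforce
  qed
  then have "countable (\<Union>m\<in>{1..}. \<Union>S\<in>Pow I. {z. mon q (t(i := z)) m S = 1})"
    using I by (intro countable_UN) (auto intro: countable_finite)
  then show ?thesis by (rule countable_subset[rotated]) (auto simp: divs_iff)
qed

text \<open>
  The identity theorem is applied to one coordinate at a time, starting from a polyannulus
  \<open>1 < norm (t i) < 1 + e\<close> contained in the region of absolute convergence.
\<close>

lemma continuation_eq_bo_sum:
  assumes I: "finite I" and q: "norm q < 1"
    and hol: "holo_in I (region I - divs q I) f"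
    and conv: "\<And>t. t \<in> conv_region q I \<Longrightarrow> f t = BO_series q I t"
    and t: "t \<in> region I - divs q I"
  shows "f t = bo_sum q {} I (I \<rightarrow>\<^sub>E UNIV) t / (\<Sum>\<^sub>\<infinity>lam\<in>partitions. q ^ psize lam)"
proof -
  let ?Z = "\<Sum>\<^sub>\<infinity>lam\<in>partitions. q ^ psize lam"
  let ?E = "\<lambda>t. bo_sum q {} I (I \<rightarrow>\<^sub>E UNIV) t / ?Z"
  obtain e where e: "e > 0" "norm q * (1 + e) ^ (2 * card I) < 1"
  proof -
    have "((\<lambda>e. norm q * (1 + e) ^ (2 * card I)) \<longlongrightarrow> norm q * (1 + 0) ^ (2 * card I)) (at_right 0)"
      by (intro tendsto_intros)
    then have "\<forall>\<^sub>F e in at_right 0. norm q * (1 + e) ^ (2 * card I) < 1"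
      using q by (intro order_tendstoD) auto
    moreover have "\<forall>\<^sub>F e in at_right 0. (0::real) < e" by (simp add: eventually_at_right_less)
    ultimately have "\<forall>\<^sub>F e in at_right 0. (0::real) < e \<and> norm q * (1 + e) ^ (2 * card I) < 1"
      by eventually_elim auto
    then show ?thesis using that by (auto dest!: eventually_happens)
  qed
  \<comment> \<open>The induction on \<open>J\<close> frees one coordinate at a time from the
    constraint \<open>norm (t k) < 1 + e\<close>; for empty \<open>J\<close> the point lies in
    \<open>conv_region\<close>.\<close>
  have "f t = ?E t" if "J \<subseteq> I" "t \<in> region I - divs q I" "\<And>k. k \<in> I - J \<Longrightarrow> norm (t k) < 1 + e" for J t
    using finite_subset[OF that(1) I] that
  proof (induction J arbitrary: t rule: finite_induct)
    case (empty t)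
    have "(\<Prod>k\<in>I. norm (t k) ^ 2) \<le> (\<Prod>k\<in>I. (1 + e) ^ 2)"
      using empty.prems(3) by (intro prod_mono conjI power_mono) (auto intro: less_imp_le)
    also have "\<dots> = (1 + e) ^ (2 * card I)" by (simp add: power_mult)
    finally have "norm q * (\<Prod>k\<in>I. norm (t k) ^ 2) \<le> norm q * (1 + e) ^ (2 * card I)"
      by (intro mult_left_mono) auto
    then have "t \<in> conv_region q I" using empty.prems(2) e(2) by (auto simp: conv_region_def)
    then show ?case using conv numerator_eq_bo_sum[OF I q] by (simp add: BO_series_def)
  next
    case (insert i J t)
    define W where "W = {z. t(i := z) \<in> region I - divs q I}"
    define T where "T = {z. t(i := z) \<in> divs q I}"
    have i: "i \<in> I" using insert.prems by auto
    have W_eq: "W = - cball 0 1 - T"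
      using insert.prems(2) i by (auto simp: W_def T_def region_def)
    have T: "countable T" unfolding T_def using insert.prems(2) by (intro slice_divs_countable I) auto
    have openW: "open W" unfolding W_def using hol by (intro open_fun_upd_vimage) (auto simp: holo_in_def)
    have connW: "connected W" unfolding W_eq using T
      by (intro path_connected_imp_connected path_connected_open_diff_countable connected_complement_bounded_convex) auto
    define U where "U = W \<inter> {z. norm z < 1 + e}"
    have "open U" unfolding U_def using openW by (intro open_Int open_Collect_less continuous_intros)
    \<comment> \<open>The annulus contains a disc, which is uncountable and so cannot lie in the
      countable exceptional set \<open>T\<close>.\<close>
    have "U \<noteq> {}"
    proof
      assume "U = {}"
      have "ball (of_real (1 + e / 2)) (e / 2) \<subseteq> T"
      proof
        fix z :: complex assume z: "z \<in> ball (of_real (1 + e / 2)) (e / 2)"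
        have n: "norm (complex_of_real (1 + e / 2)) = 1 + e / 2" using e by (simp del: of_real_add)
        have "norm z < 1 + e" "1 < norm z"
          using z norm_triangle_ineq2[of z "complex_of_real (1 + e / 2)"] norm_triangle_ineq2[of "complex_of_real (1 + e / 2)" z]
          unfolding n by (auto simp: dist_norm norm_minus_commute)
        then have "z \<in> - cball 0 1" "z \<in> {z. norm z < 1 + e}" by auto
        then show "z \<in> T" using \<open>U = {}\<close> unfolding U_def W_eq by blast
      qed
      then show False using T uncountable_ball[of "e / 2" "complex_of_real (1 + e / 2)"] e countable_subset by auto
    qed
    have "f (t(i := t i)) = ?E (t(i := t i))"
    proof (rule analytic_continuation_open[of U W "\<lambda>z. f (t(i := z))" "\<lambda>z. ?E (t(i := z))"])
      show "(\<lambda>z. f (t(i := z))) holomorphic_on W"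
        unfolding W_def by (rule holo_in_slice[OF hol i])
      have "(\<lambda>z. bo_sum q {} I (I \<rightarrow>\<^sub>E UNIV) (t(i := z))) field_differentiable (at z0)" if "z0 \<in> W" for z0
      proof -
        have reg: "t(i := z0) \<in> region I" using that by (auto simp: W_def)
        have ne: "mon q (t(i := z0)) l S \<noteq> 1" if "1 \<le> l" "S \<subseteq> I" "(l, S) \<notin> {}" for l S
          using \<open>z0 \<in> W\<close> that by (auto simp: W_def divs_iff)
        obtain V where V: "open V" "t(i := z0) \<in> V"
          "\<And>A t j. A \<subseteq> I \<rightarrow>\<^sub>E UNIV \<Longrightarrow> (\<lambda>z. bo_sum q {} I A (t(j := z))) holomorphic_on {z. t(j := z) \<in> V}"
          by (rule bo_sum_regular[of I q "t(i := z0)" "{}", OF I q reg]) (erule (2) ne, (rule that; assumption))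
        show ?thesis
          by (rule holomorphic_on_imp_differentiable_at[OF V(3)[of "I \<rightarrow>\<^sub>E UNIV" t i] open_fun_upd_vimage[OF V(1)]])
             (use V(2) in auto)
      qed
      then have "(\<lambda>z. bo_sum q {} I (I \<rightarrow>\<^sub>E UNIV) (t(i := z))) holomorphic_on W"
        by (auto simp: holomorphic_on_def intro: field_differentiable_at_within)
      then show "(\<lambda>z. ?E (t(i := z))) holomorphic_on W"
        unfolding divide_inverse by (intro holomorphic_intros)
      show "f (t(i := z)) = ?E (t(i := z))" if "z \<in> U" for z
      proof (rule insert.IH)
        show "J \<subseteq> I" using insert.prems by auto
        show "t(i := z) \<in> region I - divs q I" using that unfolding U_def W_def by blast
        show "norm ((t(i := z)) k) < 1 + e" if "k \<in> I - J" for k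
          using that \<open>z \<in> U\<close> insert.prems(3)[of k] by (cases "k = i") (auto simp: U_def)
      qed
    qed (use \<open>open U\<close> \<open>U \<noteq> {}\<close> openW connW insert.prems in \<open>auto simp: U_def W_def\<close>)
    then show ?case by simp
  qed
  from this[of I t] show ?thesis using t by simp
qed

section \<open>Extension across a hypersurface\<close>

lemma continuous_on_upd2:
  assumes "continuous_on A f" "continuous_on A g"
  shows "continuous_on A (\<lambda>x. (f x :: nat \<Rightarrow> complex)(a := g x))"
proof (rule continuous_on_coordinatewise_then_product)
  fix i show "continuous_on A (\<lambda>x. ((f x)(a := g x)) i)"
    using assms continuous_on_product_then_coordinatewise[OF assms(1), of i] by (cases "i = a") auto
qed

text \<open>
  A Riemann extension theorem for a hypersurface \<open>D\<close>.  The extension is the Cauchy integral over a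
  circle in direction \<open>a\<close> that avoids \<open>D\<close>; this makes it continuous.  Holomorphy in a direction
  transversal to \<open>D\<close> is then removability of a point, and in a direction contained in \<open>D\<close> it
  follows by a locally uniform limit of slices off \<open>D\<close>.
\<close>

lemma extend_across:
  fixes V D :: "(nat \<Rightarrow> complex) set" and G0 :: "(nat \<Rightarrow> complex) \<Rightarrow> complex"
  assumes V: "open V" "p \<in> V" "p \<in> D" and hol: "holo_in I (V - D) G0" and a: "a \<in> I"
    and one: "\<And>t z z'. t(a := z) \<in> D \<Longrightarrow> t(a := z') \<in> D \<Longrightarrow> z = z'"
    and alt: "\<And>i. i \<in> I \<Longrightarrow> (\<forall>t z z'. t(i := z) \<in> D \<longrightarrow> t(i := z') \<in> D \<longrightarrow> z = z') \<or> (\<forall>t z. t(i := z) \<in> D \<longleftrightarrow> t \<in> D)"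
    and lim: "\<And>t. t \<in> V \<Longrightarrow> t \<in> D \<Longrightarrow> ((\<lambda>z. (z - t a) * G0 (t(a := z))) \<longlongrightarrow> 0) (at (t a))"
  shows "\<exists>U G. p \<in> U \<and> U \<subseteq> V \<and> holo_in I U G \<and> (\<forall>t\<in>U - D. G t = G0 t)"
proof -
  have VD: "open (V - D)" "continuous_on (V - D) G0" using hol by (auto simp: holo_in_def)
  obtain e where e: "e > 0" "cball (p a) e \<subseteq> {z. p(a := z) \<in> V}"
    using open_fun_upd_vimage[OF V(1), of p a, unfolded open_contains_cball, rule_format, of "p a"] V(2) by auto
  have cont2: "continuous_on UNIV (\<lambda>x :: (nat \<Rightarrow> complex) \<times> complex. (fst x)(a := snd x))"
    by (intro continuous_on_upd2 continuous_intros)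
  \<comment> \<open>By compactness one circle about \<open>p a\<close> serves for all
    \<open>t\<close> near \<open>p\<close>: the disc stays in \<open>V\<close> and, in the second
    application, the circle stays off \<open>D\<close>.\<close>
  have "\<exists>X0. p \<in> X0 \<and> open X0 \<and> X0 \<times> cball (p a) e \<subseteq> (\<lambda>x. (fst x)(a := snd x)) -` V"
  proof (rule Elementary_Topology.tube_lemma)
    show "open ((\<lambda>x. (fst x)(a := snd x)) -` V)" by (rule open_vimage[OF V(1) cont2])
    show "{p} \<times> cball (p a) e \<subseteq> (\<lambda>x. (fst x)(a := snd x)) -` V" using e(2) by auto
  qed simp
  then obtain X1 where X1: "p \<in> X1" "open X1" "\<And>t z. t \<in> X1 \<Longrightarrow> z \<in> cball (p a) e \<Longrightarrow> t(a := z) \<in> V"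
    by fastforce
  have "p(a := z) \<in> V - D" if "z \<in> sphere (p a) e" for z
  proof -
    have "p(a := z) \<notin> D" using one[of p z "p a"] V(3) that e by auto
    moreover have "z \<in> cball (p a) e" using that by auto
    ultimately show ?thesis using e by auto
  qed
  then have pS: "{p} \<times> sphere (p a) e \<subseteq> (\<lambda>x. (fst x)(a := snd x)) -` (V - D)" by auto
  have "\<exists>X0. p \<in> X0 \<and> open X0 \<and> X0 \<times> sphere (p a) e \<subseteq> (\<lambda>x. (fst x)(a := snd x)) -` (V - D)"
    by (rule Elementary_Topology.tube_lemma[OF compact_sphere open_vimage[OF VD(1) cont2] pS])
  then obtain X2 where X2: "p \<in> X2" "open X2" "\<And>t z. t \<in> X2 \<Longrightarrow> z \<in> sphere (p a) e \<Longrightarrow> t(a := z) \<in> V - D"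
    by fastforce
  define U where "U = X1 \<inter> X2 \<inter> (\<lambda>t. t a) -` ball (p a) e"
  have "open ((\<lambda>t::nat \<Rightarrow> complex. t a) -` ball (p a) e)"
    by (intro open_vimage continuous_on_coord) auto
  then have openU: "open U" using X1 X2 by (auto simp: U_def)
  have pU: "p \<in> U" using X1 X2 e by (auto simp: U_def)
  have UV: "U \<subseteq> V"
  proof
    fix t assume "t \<in> U"
    then have "t(a := t a) \<in> V" by (intro X1(3)) (auto simp: U_def)
    then show "t \<in> V" by simp
  qed
  define G where "G t = contour_integral (circlepath (p a) e) (\<lambda>z. G0 (t(a := z)) / (z - t a)) / (2 * of_real pi * \<i>)" for t
  have agree: "G t = G0 t" if t: "t \<in> U - D" for t
  proof -
    define S where "S = {z. t(a := z) \<in> V}"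
    have S: "open S" "cball (p a) e \<subseteq> S"
      unfolding S_def using open_fun_upd_vimage[OF V(1)] X1(3) t by (auto simp: U_def)
    have g: "(\<lambda>z. G0 (t(a := z))) holomorphic_on {z. t(a := z) \<in> V - D}"
      by (rule holo_in_slice[OF hol a])
    \<comment> \<open>The slice meets \<open>D\<close> in at most one point, where
      \<open>lim\<close> makes the singularity removable; Cauchy's formula for the extended slice
      then gives the value of \<open>G0\<close> off \<open>D\<close>.\<close>
    have "\<exists>h. h holomorphic_on S \<and> (\<forall>z. t(a := z) \<in> V - D \<longrightarrow> h z = G0 (t(a := z)))"
    proof (cases "\<exists>z0. t(a := z0) \<in> V \<inter> D")
      case False
      then have "{z. t(a := z) \<in> V - D} = S" by (auto simp: S_def)
      then show ?thesis using g by auto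
    next
      case True
      then obtain z0 where z0: "t(a := z0) \<in> V" "t(a := z0) \<in> D" by auto
      have eq: "{z. t(a := z) \<in> V - D} = S - {z0}"
        using z0 one[of t] by (auto simp: S_def)
      have "((\<lambda>z. (z - z0) * G0 (t(a := z))) \<longlongrightarrow> 0) (at z0)"
        using lim[OF z0] by simp
      then have "\<exists>h. h holomorphic_on S \<and> (\<forall>z\<in>S - {z0}. h z = G0 (t(a := z)))"
        using g z0 S(1) unfolding eq by (subst holomorphic_on_extend_lim) (auto simp: interior_open S_def)
      then show ?thesis using eq by blast
    qed
    then obtain h where h: "h holomorphic_on S" "\<And>z. t(a := z) \<in> V - D \<Longrightarrow> h z = G0 (t(a := z))" by blast
    have "((\<lambda>u. h u / (u - t a)) has_contour_integral (2 * of_real pi * \<i> * h (t a))) (circlepath (p a) e)"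
      using t h S by (intro Cauchy_integral_circlepath_simple) (auto simp: U_def dist_norm norm_minus_commute intro: holomorphic_on_subset)
    then have "contour_integral (circlepath (p a) e) (\<lambda>u. h u / (u - t a)) = 2 * of_real pi * \<i> * h (t a)"
      by (rule contour_integral_unique)
    moreover have "contour_integral (circlepath (p a) e) (\<lambda>u. h u / (u - t a)) =
        contour_integral (circlepath (p a) e) (\<lambda>z. G0 (t(a := z)) / (z - t a))"
      using X2(3) t e h(2) by (intro contour_integral_eq) (auto simp: U_def)
    moreover have "h (t a) = G0 t" using h(2)[of "t a"] t UV by auto
    ultimately show ?thesis by (simp add: G_def)
  qed
  have contG: "continuous_on U G"
  proof -
    let ?f = "\<lambda>t x. G0 (t(a := circlepath (p a) e x)) / (circlepath (p a) e x - t a) *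
        (2 * of_real pi * \<i> * of_real e * exp (2 * of_real pi * \<i> * of_real x))"
    have G_int: "G t = integral (cbox 0 1) (?f t) / (2 * of_real pi * \<i>)" for t
      unfolding G_def contour_integral_integral vector_derivative_circlepath by simp
    have sph: "circlepath (p a) e x \<in> sphere (p a) e" if "x \<in> cbox 0 1" for x
    proof -
      have "circlepath (p a) e x \<in> path_image (circlepath (p a) e)" using that by (auto simp: path_image_def)
      then show ?thesis using e by simp
    qed
    have cc: "continuous_on (U \<times> cbox 0 1) (\<lambda>x. circlepath (p a) e (snd x))"
      unfolding circlepath by (intro continuous_intros)
    have c1: "continuous_on (U \<times> cbox 0 1) (\<lambda>x. G0 ((fst x)(a := circlepath (p a) e (snd x))))"
    proof (rule continuous_on_compose2[OF VD(2)])
      show "continuous_on (U \<times> cbox 0 1) (\<lambda>x. (fst x)(a := circlepath (p a) e (snd x)))"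
        by (intro continuous_on_upd2 cc continuous_intros)
      show "(\<lambda>x. (fst x)(a := circlepath (p a) e (snd x))) ` (U \<times> cbox 0 1) \<subseteq> V - D"
        using X2(3) sph by (fastforce simp: U_def)
    qed
    have c2: "continuous_on (U \<times> cbox (0::real) 1) (\<lambda>x. fst x a)"
      by (rule continuous_on_product_then_coordinatewise) (intro continuous_intros)
    have nz: "circlepath (p a) e (snd x) - fst x a \<noteq> 0" if "x \<in> U \<times> cbox 0 1" for x
      using sph[of "snd x"] that by (auto simp: U_def)
    have "continuous_on (U \<times> cbox 0 1) (\<lambda>x. ?f (fst x) (snd x))"
      using nz by (intro continuous_intros c1 c2 cc) auto
    then have "continuous_on (U \<times> cbox 0 1) (\<lambda>(t, x). ?f t x)"
      by (simp add: split_beta')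
    then have "continuous_on U (\<lambda>t. integral (cbox 0 1) (?f t))"
      by (rule integral_continuous_on_param)
    then show ?thesis unfolding G_int by (intro continuous_intros) auto
  qed
  have sliceG: "(\<lambda>z. G (t(i := z))) holomorphic_on {z. t(i := z) \<in> U - D}" if "i \<in> I" for t i
  proof (rule holomorphic_transform)
    show "(\<lambda>z. G0 (t(i := z))) holomorphic_on {z. t(i := z) \<in> U - D}"
      using UV by (intro holomorphic_on_subset[OF holo_in_slice[OF hol that]]) auto
    show "G0 (t(i := z)) = G (t(i := z))" if "z \<in> {z. t(i := z) \<in> U - D}" for z
      using agree that by auto
  qed
  have openUD: "open (U - D)"
  proof -
    have "U - D = U \<inter> (V - D)" using UV by auto
    then show ?thesis using openU VD(1) by auto
  qed
  have diffG: "(\<lambda>z. G (t(i := z))) field_differentiable (at (t i))" if t: "t \<in> U" and i: "i \<in> I" for t i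
  proof -
    consider "t \<notin> D" | "t \<in> D" "\<forall>t z z'. t(i := z) \<in> D \<longrightarrow> t(i := z') \<in> D \<longrightarrow> z = z'"
      | "t \<in> D" "i \<noteq> a" "\<forall>t z. t(i := z) \<in> D \<longleftrightarrow> t \<in> D"
      using alt[OF i] one by blast
    then show ?thesis
    proof cases
      case 1
      then show ?thesis
        using t by (intro holomorphic_on_imp_differentiable_at[OF sliceG[OF i] open_fun_upd_vimage[OF openUD]]) auto
    next
      case 2
      define S where "S = {z. t(i := z) \<in> U}"
      have "open S" unfolding S_def by (rule open_fun_upd_vimage[OF openU])
      have "(\<lambda>z. G (t(i := z))) holomorphic_on S"
      proof (rule no_isolated_singularity[where K = "{t i}"])
        show "continuous_on S (\<lambda>z. G (t(i := z)))"
          by (rule continuous_on_compose2[OF contG continuous_on_fun_upd]) (auto simp: S_def)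
        have "t(i := z) \<notin> D" if "z \<noteq> t i" for z
          using 2 that by (metis fun_upd_triv)
        then show "(\<lambda>z. G (t(i := z))) holomorphic_on S - {t i}"
          by (intro holomorphic_on_subset[OF sliceG[OF i]]) (auto simp: S_def)
      qed (use \<open>open S\<close> in auto)
      then show ?thesis
        using t \<open>open S\<close> by (intro holomorphic_on_imp_differentiable_at) (auto simp: S_def)
    next
      case 3
      \<comment> \<open>Here the line through \<open>t\<close> in direction \<open>i\<close> lies in
        \<open>D\<close>. Moving coordinate \<open>a\<close> away from \<open>t a\<close> leaves
        \<open>D\<close>, and changing coordinate \<open>i\<close> does not lead back, so the nearby
        parallel slices are holomorphic; the joint continuity of \<open>G\<close> makes them
        converge uniformly on a closed disc.\<close>
      have cont3: "continuous_on A (\<lambda>x. (t(a := fst x))(i := snd x))" for A :: "(complex \<times> complex) set"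
        by (intro continuous_on_upd2 continuous_intros)
      define N where "N = (\<lambda>x. (t(a := fst x))(i := snd x)) -` U"
      have "open N" unfolding N_def by (intro open_vimage openU cont3)
      moreover have "(t a, t i) \<in> N" using t 3(2) by (simp add: N_def)
      ultimately obtain A B where AB: "open A" "open B" "t a \<in> A" "t i \<in> B" "A \<times> B \<subseteq> N"
        by (auto simp: open_prod_def)
      obtain d where d: "d > 0" "cball (t i) d \<subseteq> B" using AB open_contains_cball by blast
      have cf: "continuous_on (A \<times> cball (t i) d) (\<lambda>x. G ((t(a := fst x))(i := snd x)))"
        by (rule continuous_on_compose2[OF contG cont3]) (use AB d in \<open>auto simp: N_def\<close>)
      define f where "f y z = G ((t(a := y))(i := z))" for y z
      have ul: "uniform_limit (cball (t i) d) f (f (t a)) (at (t a))"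
      proof (rule uniform_limitI)
        fix eps :: real assume "eps > 0"
        then have "eps / 2 > 0" by simp
        obtain X0 where X0: "t a \<in> X0" "open X0"
          "\<forall>x\<in>X0 \<inter> A. \<forall>z\<in>cball (t i) d. dist (G ((t(a := fst (x, z)))(i := snd (x, z)))) (G ((t(a := fst (t a, z)))(i := snd (t a, z)))) \<le> eps / 2"
          using continuous_on_prod_compactE[OF cf compact_cball AB(3) \<open>eps / 2 > 0\<close>] by blast
        have "\<forall>\<^sub>F y in at (t a). y \<in> X0 \<inter> A"
          using X0 AB by (intro eventually_at_in_open') auto
        then show "\<forall>\<^sub>F y in at (t a). \<forall>z\<in>cball (t i) d. dist (f y z) (f (t a) z) < eps"
        proof (rule eventually_mono, intro ballI)
          fix y z assume "y \<in> X0 \<inter> A" "z \<in> cball (t i) d"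
          then have "dist (f y z) (f (t a) z) \<le> eps / 2"
            using X0(3)[unfolded fst_conv snd_conv] unfolding f_def by blast
          then show "dist (f y z) (f (t a) z) < eps" using \<open>eps > 0\<close> by linarith
        qed
      qed
      have ev: "\<forall>\<^sub>F y in at (t a). continuous_on (cball (t i) d) (f y) \<and> f y holomorphic_on ball (t i) d"
      proof -
        have "\<forall>\<^sub>F y in at (t a). y \<in> A - {t a}"
          using AB by (intro eventually_at_in_open) auto
        then show ?thesis
        proof (rule eventually_mono)
          fix y assume y: "y \<in> A - {t a}"
          then have "t(a := y) \<notin> D" using one[of t y "t a"] 3(1) by auto
          then have "(t(a := y))(i := z) \<in> U - D" if "z \<in> cball (t i) d" for z
            using that y AB d 3(3) by (fastforce simp: N_def)
          then have "f y holomorphic_on cball (t i) d"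
            unfolding f_def by (intro holomorphic_on_subset[OF sliceG[OF i]]) auto
          then show "continuous_on (cball (t i) d) (f y) \<and> f y holomorphic_on ball (t i) d"
            using ball_subset_cball by (blast intro: holomorphic_on_imp_continuous_on holomorphic_on_subset)
        qed
      qed
      have "f (t a) holomorphic_on ball (t i) d"
        by (rule holomorphic_uniform_limit[OF ev ul]) auto
      then have "f (t a) field_differentiable (at (t i))"
        using d by (intro holomorphic_on_imp_differentiable_at[of _ "ball (t i) d"]) auto
      then show ?thesis by (simp add: f_def[abs_def])
    qed
  qed
  have "holo_in I U G" using openU contG diffG by (auto simp: holo_in_def)
  then show ?thesis using pU UV agree by blast
qed

subsection \<open>The singular part along a divisor\<close>

lemma bo_sum_cong:
  assumes "\<And>j. j \<in> I \<Longrightarrow> t j = t' j"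
  shows "bo_sum q X I A t = bo_sum q X I A t'"
proof -
  have "mon q t l (low I i l') = mon q t' l (low I i l')" for l l' i
    unfolding mon_def using assms by (auto simp: low_def intro!: prod.cong)
  then have "fac q X t l (low I i l') = fac q X t' l (low I i l')" for l l' i
    unfolding fac_def by metis
  moreover have "monom_part I i t = monom_part I i t'" for i
    unfolding monom_part_def using assms by (intro prod.cong) auto
  ultimately show ?thesis by (simp only: bo_sum_def bo_term_def)
qed

text \<open>The excluded pair can occur only at height \<open>m\<close>, and there exactly for the
  \<open>i\<close> in \<open>bad\<close>. Restoring it multiplies those terms by one common factor,
  which passes through the limit, and leaves the others unchanged.\<close>

lemma bo_sum_split:
  fixes I J m
  defines "A \<equiv> I \<rightarrow>\<^sub>E (UNIV :: nat set)" and "X \<equiv> {(m, J)}"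
  defines "bad \<equiv> {i \<in> A. low I i m = J}"
  assumes m: "1 \<le> m"
    and lim: "\<And>i. (\<lambda>L. \<Prod>l<L. fac q X t (Suc l) (low I i (Suc l)))
         \<longlonglongrightarrow> lim (\<lambda>L. \<Prod>l<L. fac q X t (Suc l) (low I i (Suc l)))"
    and sum: "(\<lambda>i. bo_term q X I i t) summable_on A"
  shows "bo_sum q {} I A t = bo_sum q X I (A - bad) t + 1 / (1 - mon q t m J) * bo_sum q X I bad t"
proof -
  define c where "c = 1 / (1 - mon q t m J)"
  have good: "bo_term q {} I i t = bo_term q X I i t" if "i \<in> A - bad" for i
  proof -
    have "fac q {} t (Suc l) (low I i (Suc l)) = fac q X t (Suc l) (low I i (Suc l))" for l
      using that by (auto simp: fac_def X_def bad_def)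
    then show ?thesis by (simp add: bo_term_def)
  qed
  have bad: "bo_term q {} I i t = c * bo_term q X I i t" if "i \<in> bad" for i
  proof -
    let ?P = "\<lambda>X L. \<Prod>l<L. fac q X t (Suc l) (low I i (Suc l))"
    have low: "low I i m = J" using that by (simp add: bad_def)
    have "fac q {} t (Suc l) (low I i (Suc l)) = fac q X t (Suc l) (low I i (Suc l)) * (if l = m - 1 then c else 1)" for l
      using low m by (auto simp: fac_def X_def c_def)
    then have P: "?P {} L = ?P X L * (\<Prod>l<L. if l = m - 1 then c else 1)" for L
      by (simp add: prod.distrib)
    have "?P {} L = ?P X L * c" if "L \<ge> m" for L
      unfolding P using that m by (simp add: prod.delta)
    then have "\<forall>\<^sub>F L in sequentially. ?P X L * c = ?P {} L"
      by (intro eventually_sequentiallyI[of m]) simp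
    moreover have "(\<lambda>L. ?P X L * c) \<longlonglongrightarrow> lim (?P X) * c"
      by (intro tendsto_intros lim)
    ultimately have "?P {} \<longlonglongrightarrow> lim (?P X) * c"
      by (rule Lim_transform_eventually[rotated])
    then show ?thesis unfolding bo_term_def by (simp add: limI)
  qed
  have sumX: "(\<lambda>i. bo_term q X I i t) summable_on (A - bad)" "(\<lambda>i. bo_term q X I i t) summable_on bad"
    using sum by (auto intro: summable_on_subset_banach simp: bad_def)
  have "bo_sum q {} I A t = (\<Sum>\<^sub>\<infinity>i\<in>(A - bad) \<union> bad. bo_term q {} I i t)"
    unfolding bo_sum_def by (rule infsum_cong_neutral) (auto simp: bad_def)
  also have "\<dots> = (\<Sum>\<^sub>\<infinity>i\<in>A - bad. bo_term q {} I i t) + (\<Sum>\<^sub>\<infinity>i\<in>bad. bo_term q {} I i t)"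
  proof (rule infsum_Un_disjoint)
    show "(\<lambda>i. bo_term q {} I i t) summable_on (A - bad)"
      using sumX(1) by (subst summable_on_cong[OF good])
    show "(\<lambda>i. bo_term q {} I i t) summable_on bad"
      using summable_on_cmult_right[OF sumX(2), of c] by (subst summable_on_cong[OF bad])
  qed auto
  also have "(\<Sum>\<^sub>\<infinity>i\<in>A - bad. bo_term q {} I i t) = bo_sum q X I (A - bad) t"
    unfolding bo_sum_def by (rule infsum_cong[OF good])
  also have "(\<Sum>\<^sub>\<infinity>i\<in>bad. bo_term q {} I i t) = (\<Sum>\<^sub>\<infinity>i\<in>bad. c * bo_term q X I i t)"
    by (rule infsum_cong[OF bad])
  also have "\<dots> = c * bo_sum q X I bad t"
    unfolding bo_sum_def by (rule infsum_cmult_right')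
  finally show ?thesis by (simp add: c_def)
qed

text \<open>The rows of \<open>K\<close> are counted from \<open>m\<close> on, so the second
  component ranges over all functions on \<open>K\<close>.\<close>

definition glue :: "nat set \<Rightarrow> nat set \<Rightarrow> nat \<Rightarrow> (nat \<Rightarrow> nat) \<times> (nat \<Rightarrow> nat) \<Rightarrow> nat \<Rightarrow> nat" where
  "glue J K m = (\<lambda>(i1, i2). \<lambda>j\<in>J \<union> K. if j \<in> J then i1 j else i2 j + m)"

lemma bij_glue:
  assumes "J \<inter> K = {}"
  shows "bij_betw (glue J K m) ((J \<rightarrow>\<^sub>E {..<m}) \<times> (K \<rightarrow>\<^sub>E UNIV)) {i \<in> J \<union> K \<rightarrow>\<^sub>E UNIV. low (J \<union> K) i m = J}"
proof (rule bij_betwI[where g = "\<lambda>i. (restrict i J, \<lambda>j\<in>K. i j - m)"])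
  show "glue J K m \<in> (J \<rightarrow>\<^sub>E {..<m}) \<times> (K \<rightarrow>\<^sub>E UNIV) \<rightarrow> {i \<in> J \<union> K \<rightarrow>\<^sub>E UNIV. low (J \<union> K) i m = J}"
    using assms by (fastforce simp: glue_def low_def PiE_iff)
  show "(\<lambda>i. (restrict i J, \<lambda>j\<in>K. i j - m)) \<in> {i \<in> J \<union> K \<rightarrow>\<^sub>E UNIV. low (J \<union> K) i m = J} \<rightarrow> (J \<rightarrow>\<^sub>E {..<m}) \<times> (K \<rightarrow>\<^sub>E UNIV)"
    by (auto simp: low_def)
  show "(restrict (glue J K m x) J, \<lambda>j\<in>K. glue J K m x j - m) = x"
    if x: "x \<in> (J \<rightarrow>\<^sub>E {..<m}) \<times> (K \<rightarrow>\<^sub>E UNIV)" for x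
  proof -
    obtain i1 i2 where x': "x = (i1, i2)" by (cases x)
    have "restrict (glue J K m x) J j = i1 j" for j
      using x PiE_arb[of i1 J _ j] by (auto simp: x' glue_def)
    moreover have "(\<lambda>j\<in>K. glue J K m x j - m) j = i2 j" for j
      using x PiE_arb[of i2 K _ j] assms by (auto simp: x' glue_def)
    ultimately show ?thesis unfolding x' by blast
  qed
  show "glue J K m (restrict i J, \<lambda>j\<in>K. i j - m) = i" if i: "i \<in> {i \<in> J \<union> K \<rightarrow>\<^sub>E UNIV. low (J \<union> K) i m = J}" for i
  proof
    fix j
    have "i j \<ge> m" if "j \<in> K" using i that assms by (force simp: low_def)
    then show "glue J K m (restrict i J, \<lambda>j\<in>K. i j - m) j = i j"
      using i PiE_arb[of i "J \<union> K" _ j] by (auto simp: glue_def)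
  qed
qed

text \<open>Heights below \<open>m\<close> see only \<open>J\<close>, and the factor at height
  \<open>m\<close> has been stripped. At height \<open>l + m\<close> all of \<open>J\<close> is
  present and contributes \<open>mon q t m J = 1\<close>, leaving the factor of \<open>K\<close> at
  height \<open>l\<close>. The shift of rows by \<open>m\<close> in \<open>monom_part\<close> gives
  the power of the product over \<open>K\<close>.\<close>

lemma bo_term_glue:
  fixes J K m
  defines "I \<equiv> J \<union> K" and "X \<equiv> {(m, J)}"
  assumes fin: "finite J" "finite K" and dis: "J \<inter> K = {}" and m: "1 \<le> m"
    and i1: "i1 \<in> J \<rightarrow>\<^sub>E {..<m}"
    and tnz: "\<And>j. j \<in> K \<Longrightarrow> t j \<noteq> 0" and one: "mon q t m J = 1"
    and gen: "\<And>l S. 1 \<le> l \<Longrightarrow> l < m \<Longrightarrow> S \<subseteq> J \<Longrightarrow> mon q t l S \<noteq> 1"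
    and lim: "\<And>i. (\<lambda>L. \<Prod>l<L. fac q X t (Suc l) (low I i (Suc l)))
         \<longlonglongrightarrow> lim (\<lambda>L. \<Prod>l<L. fac q X t (Suc l) (low I i (Suc l)))"
  shows "bo_term q X I (glue J K m (i1, i2)) t =
     monom_part J i1 t * (\<Prod>l=1..<m. 1 / (1 - mon q t l (low J i1 l))) * (bo_term q {} K i2 t / (\<Prod>j\<in>K. (t j)\<^sup>2) ^ m)"
proof -
  define g where "g = glue J K m (i1, i2)"
  have gJ: "g j = i1 j" "i1 j < m" if "j \<in> J" for j using that i1 by (auto simp: g_def glue_def)
  have gK: "g j = i2 j + m" if "j \<in> K" for j using that dis by (auto simp: g_def glue_def)
  have low1: "low I g l = low J i1 l" if "l \<le> m" for l
    using that gJ gK by (auto simp: low_def I_def)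
  have low2: "low I g (l + m) = J \<union> low K i2 l" for l
    using gJ gK by (auto simp: low_def I_def intro: trans_less_add2)
  have lowm: "low J i1 m = J" using gJ by (auto simp: low_def)
  define P1 where "P1 = (\<Prod>l=1..<m. 1 / (1 - mon q t l (low J i1 l)))"
  have P1nz: "P1 \<noteq> 0"
    unfolding P1_def using gen by (auto simp: low_def)
  have first: "(\<Prod>l<m. fac q X t (Suc l) (low I g (Suc l))) = P1"
  proof -
    obtain m' where m': "m = Suc m'" using m by (cases m) auto
    have "(\<Prod>l<m. fac q X t (Suc l) (low I g (Suc l))) = (\<Prod>l<m'. fac q X t (Suc l) (low I g (Suc l)))"
      unfolding m' using low1[of m] lowm by (simp add: fac_def X_def m')
    also have "\<dots> = (\<Prod>l<m'. 1 / (1 - mon q t (Suc l) (low J i1 (Suc l))))"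
      by (intro prod.cong refl) (auto simp: fac_def X_def m' low1)
    also have "\<dots> = P1"
      unfolding P1_def m' lessThan_atLeast0 One_nat_def prod.shift_bounds_Suc_ivl ..
    finally show ?thesis .
  qed
  have second: "fac q X t (Suc (l + m)) (low I g (Suc (l + m))) = fac q {} t (Suc l) (low K i2 (Suc l))" for l
  proof -
    have "J \<inter> low K i2 (Suc l) = {}" using dis by (auto simp: low_def)
    then have "mon q t (Suc l + m) (J \<union> low K i2 (Suc l)) = mon q t m J * mon q t (Suc l) (low K i2 (Suc l))"
      using fin by (simp add: mon_def prod.union_disjoint power_add low_def)
    then show ?thesis using low2[of "Suc l"] one by (simp add: fac_def X_def)
  qed
  have split: "(\<Prod>l<L + m. fac q X t (Suc l) (low I g (Suc l))) = P1 * (\<Prod>l<L. fac q {} t (Suc l) (low K i2 (Suc l)))" for L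
  proof -
    have "(\<Prod>l<L + m. fac q X t (Suc l) (low I g (Suc l))) =
       (\<Prod>l<m. fac q X t (Suc l) (low I g (Suc l))) * (\<Prod>l<L. fac q X t (Suc (l + m)) (low I g (Suc (l + m))))"
      by (induction L) (auto simp: mult_ac)
    then show ?thesis by (simp only: first second)
  qed
  let ?L = "lim (\<lambda>L. \<Prod>l<L. fac q X t (Suc l) (low I g (Suc l)))"
  \<comment> \<open>Since \<open>P1\<close> is nonzero, the convergence of the products over
    \<open>K\<close> is inherited from those over \<open>I\<close>.\<close>
  have "(\<lambda>L. P1 * (\<Prod>l<L. fac q {} t (Suc l) (low K i2 (Suc l)))) \<longlonglongrightarrow> ?L"
    using LIMSEQ_ignore_initial_segment[OF lim[of g], of m] by (simp only: split)
  then have "(\<lambda>L. P1 * (\<Prod>l<L. fac q {} t (Suc l) (low K i2 (Suc l))) / P1) \<longlonglongrightarrow> ?L / P1"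
    using P1nz by (intro tendsto_intros)
  then have "?L = P1 * lim (\<lambda>L. \<Prod>l<L. fac q {} t (Suc l) (low K i2 (Suc l)))"
    using P1nz by (simp add: limI)
  moreover have "monom_part I g t = monom_part J i1 t * (monom_part K i2 t / (\<Prod>j\<in>K. (t j)\<^sup>2) ^ m)"
  proof -
    have "t j powi (- 2 * int (g j) - 1) = t j powi (- 2 * int (i2 j) - 1) / ((t j)\<^sup>2) ^ m" if "j \<in> K" for j
    proof -
      have "- 2 * int (i2 j) - 1 = 2 * int m - 2 * int (g j) - 1" using gK[OF that] by simp
      then show ?thesis using powi_shift[OF tnz[OF that], of m "g j"] tnz[OF that] by simp
    qed
    then have "(\<Prod>j\<in>K. t j powi (- 2 * int (g j) - 1)) = monom_part K i2 t / (\<Prod>j\<in>K. (t j)\<^sup>2) ^ m"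
      by (simp add: monom_part_def prod_dividef prod_power_distrib)
    moreover have "(\<Prod>j\<in>J. t j powi (- 2 * int (g j) - 1)) = monom_part J i1 t"
      unfolding monom_part_def by (intro prod.cong) (auto simp: gJ)
    ultimately show ?thesis
      unfolding I_def monom_part_def[of "J \<union> K"] using fin dis by (simp add: prod.union_disjoint)
  qed
  ultimately show ?thesis
    unfolding bo_term_def g_def[symmetric] P1_def[symmetric] by (simp add: mult_ac)
qed

text \<open>Under \<open>glue\<close> each term is a function of \<open>i1\<close> times a function
  of \<open>i2\<close>. The sum over \<open>i1\<close> is the finite residue sum; the sum over
  \<open>i2\<close> is the series for \<open>K\<close>.\<close>

lemma bo_sum_bad_on_divisor:
  fixes J K m
  defines "I \<equiv> J \<union> K" and "X \<equiv> {(m, J)}"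
  defines "bad \<equiv> {i \<in> I \<rightarrow>\<^sub>E UNIV. low I i m = J}"
  assumes fin: "finite J" "finite K" "J \<noteq> {}" and dis: "J \<inter> K = {}" and m: "1 \<le> m"
    and q0: "q \<noteq> 0" and r: "r\<^sup>2 = q" and one: "r ^ m * (\<Prod>j\<in>J. t j) = 1"
    and tnz: "\<And>j. j \<in> K \<Longrightarrow> t j \<noteq> 0"
    and gen: "\<And>l S. 1 \<le> l \<Longrightarrow> l < m \<Longrightarrow> S \<subseteq> J \<Longrightarrow> mon q t l S \<noteq> 1"
    and lim: "\<And>i. (\<lambda>L. \<Prod>l<L. fac q X t (Suc l) (low I i (Suc l)))
         \<longlonglongrightarrow> lim (\<lambda>L. \<Prod>l<L. fac q X t (Suc l) (low I i (Suc l)))"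
    and sum: "(\<lambda>i. bo_term q X I i t) summable_on (I \<rightarrow>\<^sub>E UNIV)"
  shows "bo_sum q X I bad t = (-1) ^ (m - 1) * r ^ (m\<^sup>2) * of_nat m ^ (card J - 1) *
           (bo_sum q {} K (K \<rightarrow>\<^sub>E UNIV) t / (\<Prod>j\<in>K. (t j)\<^sup>2) ^ m)"
proof -
  let ?B = "(J \<rightarrow>\<^sub>E {..<m}) \<times> (K \<rightarrow>\<^sub>E UNIV)"
  define h where "h i1 = monom_part J i1 t * (\<Prod>l=1..<m. 1 / (1 - mon q t l (low J i1 l)))" for i1
  define g where "g i2 = bo_term q {} K i2 t / (\<Prod>j\<in>K. (t j)\<^sup>2) ^ m" for i2
  have bij: "bij_betw (glue J K m) ?B bad"
    unfolding bad_def I_def by (rule bij_glue[OF dis])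
  have one': "mon q t m J = 1"
  proof -
    have "mon q t m J = (r ^ m * (\<Prod>j\<in>J. t j))\<^sup>2"
      by (simp add: mon_def r[symmetric] power_mult_distrib prod_power_distrib power_mult[symmetric] mult.commute)
    then show ?thesis using one by simp
  qed
  have eq: "bo_term q X I (glue J K m x) t = (\<lambda>(i1, i2). h i1 * g i2) x" if "x \<in> ?B" for x
    using that bo_term_glue[OF fin(1,2) dis m _ tnz one' gen lim[unfolded I_def X_def]]
    by (auto simp: h_def g_def I_def X_def)
  have "(\<lambda>i. bo_term q X I i t) summable_on bad"
    by (rule summable_on_subset_banach[OF sum]) (auto simp: bad_def)
  then have "(\<lambda>x. bo_term q X I (glue J K m x) t) summable_on ?B"
    by (simp only: summable_on_reindex_bij_betw[OF bij, of "\<lambda>i. bo_term q X I i t"])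
  also have "?this \<longleftrightarrow> (\<lambda>(i1, i2). h i1 * g i2) summable_on ?B"
    by (rule summable_on_cong) (rule eq)
  finally have sB: "(\<lambda>(i1, i2). h i1 * g i2) summable_on ?B" .
  have "bo_sum q X I bad t = (\<Sum>\<^sub>\<infinity>x\<in>?B. bo_term q X I (glue J K m x) t)"
    unfolding bo_sum_def by (rule infsum_reindex_bij_betw[OF bij, symmetric])
  also have "\<dots> = (\<Sum>\<^sub>\<infinity>x\<in>?B. (\<lambda>(i1, i2). h i1 * g i2) x)"
    by (rule infsum_cong) (rule eq)
  also have "\<dots> = (\<Sum>\<^sub>\<infinity>i1\<in>J \<rightarrow>\<^sub>E {..<m}. \<Sum>\<^sub>\<infinity>i2\<in>K \<rightarrow>\<^sub>E UNIV. h i1 * g i2)"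
    by (rule infsum_Sigma'_banach[OF sB, symmetric])
  also have "\<dots> = (\<Sum>i1\<in>J \<rightarrow>\<^sub>E {..<m}. h i1) * (\<Sum>\<^sub>\<infinity>i2\<in>K \<rightarrow>\<^sub>E UNIV. g i2)"
  proof -
    have "finite (J \<rightarrow>\<^sub>E {..<m})" using fin by (intro finite_PiE) auto
    then show ?thesis by (simp only: infsum_cmult_right' infsum_finite sum_distrib_right)
  qed
  also have "(\<Sum>i1\<in>J \<rightarrow>\<^sub>E {..<m}. h i1) = (-1) ^ (m - 1) * r ^ (m\<^sup>2) * of_nat m ^ (card J - 1)"
    unfolding h_def monom_part_def by (rule sum_terms_on_divisor[OF fin(1,3) q0 r one m gen])
  also have "(\<Sum>\<^sub>\<infinity>i2\<in>K \<rightarrow>\<^sub>E UNIV. g i2) = bo_sum q {} K (K \<rightarrow>\<^sub>E UNIV) t / (\<Prod>j\<in>K. (t j)\<^sup>2) ^ m"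
    unfolding g_def bo_sum_def divide_inverse by (rule infsum_cmult_left')
  finally show ?thesis .
qed

theorem theorem9p1:
  fixes q r :: complex and F :: "nat set \<Rightarrow> (nat \<Rightarrow> complex) \<Rightarrow> complex"
    and n k m :: nat and p :: "nat \<Rightarrow> complex"
  assumes q: "0 < norm q" "norm q < 1" and r: "r\<^sup>2 = q"
    and F: "\<And>I. finite I \<Longrightarrow>
              holo_in I (region I - divs q I) (F I) \<and>
              (\<forall>t\<in>conv_region q I. F I t = BO_series q I t)"
    and nk: "1 \<le> n" "1 \<le> k" "k \<le> n" and m: "1 \<le> m"
    and p_reg: "p \<in> region {0..<n}"
    and p_div: "r ^ m * (\<Prod>j<k. p j) = 1"
    and p_gen: "\<And>m' S. 1 \<le> m' \<Longrightarrow> S \<subseteq> {0..<n} \<Longrightarrow> (m', S) \<noteq> (m, {0..<k}) \<Longrightarrow>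
                  q ^ m' * (\<Prod>j\<in>S. (p j)\<^sup>2) \<noteq> 1"
  shows "\<exists>U G. p \<in> U \<and> U \<subseteq> region {0..<n} \<and> holo_in {0..<n} U G \<and>
           (\<forall>t\<in>U - divs q {0..<n}.
              F {0..<n} t =
                (-1) ^ m * r ^ (m\<^sup>2) * of_nat m ^ (k - 1)
                  / (q ^ m * (\<Prod>j<k. (t j)\<^sup>2) - 1)
                * (F {k..<n} t / (\<Prod>j\<in>{k..<n}. (t j)\<^sup>2) ^ m)
                + G t)"
proof -
  define I J K where "I = {0..<n}" and "J = {..<k}" and "K = {k..<n}"
  define X where "X = {(m, J)}"
  define A where "A = I \<rightarrow>\<^sub>E (UNIV :: nat set)"
  define bad where "bad = {i \<in> A. low I i m = J}"
  define Z where "Z = (\<Sum>\<^sub>\<infinity>lam\<in>partitions. q ^ psize lam)"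
  define c where "c = (-1) ^ m * r ^ (m\<^sup>2) * of_nat m ^ (k - 1)"
  have fin: "finite I" "finite J" "finite K" by (auto simp: I_def J_def K_def)
  have I_eq: "I = J \<union> K" and dis: "J \<inter> K = {}" and J0: "0 \<in> J" "0 \<in> I" "0 \<notin> K"
    using nk by (auto simp: I_def J_def K_def)
  have q0: "q \<noteq> 0" using q by auto
  have holF: "holo_in I' (region I' - divs q I') (F I')"
    and F_eq: "t \<in> region I' - divs q I' \<Longrightarrow> F I' t = bo_sum q {} I' (I' \<rightarrow>\<^sub>E UNIV) t / Z" if "finite I'" for I' t
    using F[OF that] continuation_eq_bo_sum[OF that q(2), of "F I'" t] by (auto simp: Z_def)
  have gen: "mon q p l S \<noteq> 1" if "1 \<le> l" "S \<subseteq> I" "(l, S) \<notin> X" for l S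
    using p_gen[of l S] that by (auto simp: mon_def X_def I_def J_def lessThan_atLeast0)
  obtain V where V: "open V" "p \<in> V" "V \<subseteq> region I"
    and Vgen: "\<And>t l S. t \<in> V \<Longrightarrow> 1 \<le> l \<Longrightarrow> S \<subseteq> I \<Longrightarrow> (l, S) \<notin> X \<Longrightarrow> mon q t l S \<noteq> 1"
    and Vlim: "\<And>t i. t \<in> V \<Longrightarrow> (\<lambda>L. \<Prod>l<L. fac q X t (Suc l) (low I i (Suc l)))
         \<longlonglongrightarrow> lim (\<lambda>L. \<Prod>l<L. fac q X t (Suc l) (low I i (Suc l)))"
    and Vsum: "\<And>t. t \<in> V \<Longrightarrow> (\<lambda>i. bo_term q X I i t) summable_on (I \<rightarrow>\<^sub>E UNIV)"
    and Vhol: "\<And>B t j. B \<subseteq> I \<rightarrow>\<^sub>E UNIV \<Longrightarrow> (\<lambda>z. bo_sum q X I B (t(j := z))) holomorphic_on {z. t(j := z) \<in> V}"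
    by (rule bo_sum_regular[of I q p X, OF fin(1) q(2) p_reg[folded I_def]]) (erule (2) gen, (rule that; assumption))
  \<comment> \<open>A square root of the monomial \<open>mon q t m J\<close> that is 1 at
    \<open>p\<close>; it tells the two sheets of the divisor apart.\<close>
  define w where "w t = r ^ m * (\<Prod>j\<in>J. t j)" for t :: "nat \<Rightarrow> complex"
  have mon_w: "mon q t m J = (w t)\<^sup>2" for t
    by (simp add: mon_def w_def r[symmetric] power_mult_distrib prod_power_distrib power_mult[symmetric] mult.commute)
  have w_cont: "continuous_on B w" for B unfolding w_def by (intro continuous_intros)
  define D where "D = {t. w t = 1}"
  \<comment> \<open>With the sheet \<open>w t = -1\<close> removed, \<open>D\<close> is all that
    \<open>V0\<close> contains of the divisors.\<close>
  define V0 where "V0 = V \<inter> {t. w t \<noteq> -1}"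
  have V0: "open V0" "p \<in> V0" "V0 \<subseteq> V"
    using V p_div w_cont by (auto simp: V0_def w_def J_def intro!: open_Int open_Collect_neq continuous_intros)
  have opVD: "open (V0 - D)"
  proof -
    have "V0 - D = V0 \<inter> {t. w t \<noteq> 1}" by (auto simp: D_def)
    moreover have "open {t. w t \<noteq> 1}" using w_cont by (intro open_Collect_neq continuous_intros)
    ultimately show ?thesis using V0 by auto
  qed
  have divs_D: "t \<in> divs q I \<longleftrightarrow> t \<in> D" if "t \<in> V0" for t
  proof
    assume "t \<in> divs q I"
    then obtain l S where lS: "1 \<le> l" "S \<subseteq> I" "mon q t l S = 1" by (auto simp: divs_iff)
    then have "(l, S) \<in> X" using Vgen[of t l S] that V0 by auto
    then have "(w t)\<^sup>2 = 1" using lS mon_w by (auto simp: X_def)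
    then show "t \<in> D" using that by (auto simp: D_def V0_def power2_eq_1_iff)
  next
    assume "t \<in> D"
    then have "mon q t m J = 1" by (simp add: mon_w D_def)
    then show "t \<in> divs q I" using m I_eq by (auto simp: divs_iff)
  qed
  have VDreg: "t \<in> region I - divs q I" if "t \<in> V0 - D" for t
    using that divs_D V0 V by auto
  have VK: "t \<in> region K - divs q K" if "t \<in> V0" for t
  proof -
    have "t \<in> region I" using that V0 V by auto
    moreover have "mon q t l S \<noteq> 1" if "1 \<le> l" "S \<subseteq> K" for l S
    proof (rule Vgen)
      have "S \<noteq> J" using that J0 by auto
      then show "(l, S) \<notin> X" by (simp add: X_def)
    qed (use that I_eq \<open>t \<in> V0\<close> V0 in auto)
    ultimately show ?thesis by (auto simp: region_def I_eq divs_iff)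
  qed
  have tnz: "t j \<noteq> 0" if "t \<in> V0" "j \<in> I" for t j
    using that V0 V by (force simp: region_def)
  have KI: "K \<subseteq> I" and JI: "J \<subseteq> I" using I_eq by auto
  \<comment> \<open>The assumptions on \<open>F K\<close> do not say that it ignores the coordinates
    outside \<open>K\<close>; this comes from the series representation.\<close>
  have FK_const: "F K (t(i := z)) = F K (t(i := z'))" if "t(i := z) \<in> V0" "t(i := z') \<in> V0" "i \<notin> K" for t i z z'
  proof -
    have "bo_sum q {} K (K \<rightarrow>\<^sub>E UNIV) (t(i := z)) = bo_sum q {} K (K \<rightarrow>\<^sub>E UNIV) (t(i := z'))"
      using that by (intro bo_sum_cong) auto
    then show ?thesis using VK that by (simp add: F_eq[OF fin(3)])
  qed
  have FK_hol: "(\<lambda>z. F K (t(i := z))) holomorphic_on {z. t(i := z) \<in> V0}" for t i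
  proof (cases "i \<in> K")
    case True
    show ?thesis
      by (rule holomorphic_on_subset[OF holo_in_slice[OF holF[OF fin(3)] True]]) (use VK in blast)
  next
    case False
    show ?thesis
    proof (cases "{z. t(i := z) \<in> V0} = {}")
      case True
      show ?thesis unfolding True by (simp add: holomorphic_on_def)
    next
      case ne: False
      then obtain z0 where z0: "t(i := z0) \<in> V0" by auto
      have "(\<lambda>z. F K (t(i := z0))) holomorphic_on {z. t(i := z) \<in> V0}" by (rule holomorphic_on_const)
      then show ?thesis
        by (rule holomorphic_transform) (use FK_const[OF z0 _ False] in blast)
    qed
  qed
  define Y where "Y t = F K t / (\<Prod>j\<in>K. (t j)\<^sup>2) ^ m" for t
  define G0 where "G0 t = F I t - c / (mon q t m J - 1) * Y t" for t
  have mon1: "mon q t m J - 1 \<noteq> 0" if "t \<in> V0 - D" for t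
    using that mon_w by (auto simp: V0_def D_def power2_eq_1_iff)
  have prodnz: "(\<Prod>j\<in>K. (t j)\<^sup>2) ^ m \<noteq> 0" if "t \<in> V0" for t
    using tnz[OF that] KI fin by auto
  have G0_hol: "(\<lambda>z. G0 (t(i := z))) holomorphic_on {z. t(i := z) \<in> V0 - D}" if "i \<in> I" for t i
  proof -
    have "(\<lambda>z. F I (t(i := z))) holomorphic_on {z. t(i := z) \<in> V0 - D}"
      by (rule holomorphic_on_subset[OF holo_in_slice[OF holF[OF fin(1)] that]]) (use VDreg in blast)
    moreover have "(\<lambda>z. F K (t(i := z))) holomorphic_on {z. t(i := z) \<in> V0 - D}"
      by (rule holomorphic_on_subset[OF FK_hol]) blast
    moreover have "(\<lambda>z. mon q (t(i := z)) m J) holomorphic_on {z. t(i := z) \<in> V0 - D}"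
      unfolding mon_def by (intro holomorphic_intros)
    ultimately show ?thesis unfolding G0_def Y_def
      by (intro holomorphic_intros) (use mon1 prodnz in blast)+
  qed
  have G0_holo: "holo_in I (V0 - D) G0"
    unfolding holo_in_def
  proof (intro conjI ballI opVD)
    have "continuous_on (V0 - D) (F I)"
      by (rule continuous_on_subset[of "region I - divs q I"]) (use holF[OF fin(1)] VDreg in \<open>auto simp: holo_in_def\<close>)
    moreover have "continuous_on (V0 - D) (F K)"
      by (rule continuous_on_subset[of "region K - divs q K"]) (use holF[OF fin(3)] VK in \<open>auto simp: holo_in_def\<close>)
    ultimately show "continuous_on (V0 - D) G0" unfolding G0_def Y_def
      by (intro continuous_intros ballI) (use mon1 prodnz in blast)+
    show "(\<lambda>z. G0 (t(i := z))) field_differentiable at (t i)" if "t \<in> V0 - D" "i \<in> I" for t i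
      by (rule holomorphic_on_imp_differentiable_at[OF G0_hol[OF that(2)] open_fun_upd_vimage[OF opVD]])
         (use that in auto)
  qed
  have w_upd: "w (t(i := z)) = z * (r ^ m * (\<Prod>j\<in>J - {i}. t j))" if "i \<in> J" for t i z
    unfolding w_def using that fin by (simp add: prod.remove[of J i])
  have w_upd': "w (t(i := z)) = w t" if "i \<notin> J" for t i z
    unfolding w_def using that by (intro arg_cong2[where f = "(*)"] prod.cong) auto
  have D_one: "z = z'" if "i \<in> J" "t(i := z) \<in> D" "t(i := z') \<in> D" for t i z z'
  proof -
    have "z * (r ^ m * (\<Prod>j\<in>J - {i}. t j)) = 1" "z' * (r ^ m * (\<Prod>j\<in>J - {i}. t j)) = 1"
      using that w_upd[OF that(1)] by (auto simp: D_def)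
    then show ?thesis by (metis mult_right_cancel mult_zero_right zero_neq_one)
  qed
  \<comment> \<open>Direction 0 belongs to \<open>J\<close> and is transversal to \<open>D\<close>.
    Along it \<open>G0\<close> is \<open>good\<close> plus \<open>res\<close> times a function with
    a simple pole, and \<open>res\<close> vanishes on \<open>D\<close>.\<close>
  have lim0: "((\<lambda>z. (z - t 0) * G0 (t(0 := z))) \<longlongrightarrow> 0) (at (t 0))" if t: "t \<in> V0" "t \<in> D" for t
  proof -
    define good where "good z = bo_sum q X I (A - bad) (t(0 := z)) / Z" for z
    define res where "res z = bo_sum q X I bad (t(0 := z)) / Z + c * Y t" for z
    have op: "open {z. t(0 := z) \<in> V0}" by (rule open_fun_upd_vimage[OF V0(1)])
    have t0: "t 0 \<noteq> 0" using tnz[OF t(1)] J0 by auto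
    have cont: "isCont (\<lambda>z. bo_sum q X I B (t(0 := z))) (t 0)" if "B \<subseteq> A" for B
    proof (rule field_differentiable_imp_continuous_at, rule holomorphic_on_imp_differentiable_at)
      show "(\<lambda>z. bo_sum q X I B (t(0 := z))) holomorphic_on {z. t(0 := z) \<in> V}"
        using Vhol that by (auto simp: A_def)
      show "open {z. t(0 := z) \<in> V}" by (rule open_fun_upd_vimage[OF V(1)])
    qed (use t V0 in auto)
    \<comment> \<open>The constant in \<open>bo_sum_bad_on_divisor\<close> has the sign
      \<open>(-1) ^ (m - 1)\<close> and \<open>c\<close> has \<open>(-1) ^ m\<close>, so the two
      contributions cancel.\<close>
    have res0: "res (t 0) = 0"
    proof -
      have "bo_sum q X I bad t = (-1) ^ (m - 1) * r ^ (m\<^sup>2) * of_nat m ^ (card J - 1) *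
           (bo_sum q {} K (K \<rightarrow>\<^sub>E UNIV) t / (\<Prod>j\<in>K. (t j)\<^sup>2) ^ m)"
        unfolding bad_def A_def X_def I_eq
      proof (rule bo_sum_bad_on_divisor[OF fin(2,3) _ dis m q0 r])
        show "J \<noteq> {}" using J0 by auto
        show "r ^ m * prod t J = 1" using t by (simp add: D_def w_def)
        show "t j \<noteq> 0" if "j \<in> K" for j using tnz[OF t(1)] that KI by auto
        show "mon q t l S \<noteq> 1" if "1 \<le> l" "l < m" "S \<subseteq> J" for l S
          using that t V0 JI by (intro Vgen) (auto simp: X_def)
        show "(\<lambda>L. \<Prod>l<L. fac q {(m, J)} t (Suc l) (low (J \<union> K) i (Suc l)))
           \<longlonglongrightarrow> lim (\<lambda>L. \<Prod>l<L. fac q {(m, J)} t (Suc l) (low (J \<union> K) i (Suc l)))" for i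
          using Vlim[of t i] t V0 unfolding X_def I_eq by blast
        show "(\<lambda>i. bo_term q {(m, J)} (J \<union> K) i t) summable_on J \<union> K \<rightarrow>\<^sub>E UNIV"
          using Vsum[of t] t V0 unfolding X_def I_eq by blast
      qed
      moreover have "(-1 :: complex) ^ m = - ((-1) ^ (m - 1))" using m by (cases m) auto
      moreover have "card J = k" by (simp add: J_def)
      ultimately show ?thesis
        unfolding res_def Y_def F_eq[OF fin(3) VK[OF t(1)]] c_def by (simp add: field_simps)
    qed
    have Y_eq: "Y (t(0 := z)) = Y t" if "t(0 := z) \<in> V0" for z
    proof -
      have "F K (t(0 := z)) = F K t" using FK_const[of t 0 z "t 0"] that t J0 by simp
      moreover have "(\<Prod>j\<in>K. ((t(0 := z)) j)\<^sup>2) = (\<Prod>j\<in>K. (t j)\<^sup>2)" using J0 by (intro prod.cong) auto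
      ultimately show ?thesis by (simp only: Y_def)
    qed
    \<comment> \<open>On this line \<open>mon q (t(0 := z)) m J = z\<^sup>2 / (t 0)\<^sup>2\<close>,
      because \<open>w t = 1\<close>. Hence \<open>z - t 0\<close> times
      \<open>1 / (1 - mon q (t(0 := z)) m J)\<close> is \<open>- (t 0)\<^sup>2 / (t 0 + z)\<close>,
      which is regular at \<open>z = t 0\<close>.\<close>
    have "((\<lambda>z. (z - t 0) * good z - (t 0)\<^sup>2 / (t 0 + z) * res z) \<longlongrightarrow>
        (t 0 - t 0) * good (t 0) - (t 0)\<^sup>2 / (t 0 + t 0) * res (t 0)) (at (t 0))"
    proof -
      have "(good \<longlongrightarrow> good (t 0)) (at (t 0))"
        unfolding good_def divide_inverse using cont[of "A - bad"] by (intro tendsto_intros) (auto simp: isCont_def)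
      moreover have "(res \<longlongrightarrow> res (t 0)) (at (t 0))"
        unfolding res_def divide_inverse using cont[of bad] by (intro tendsto_intros) (auto simp: isCont_def bad_def)
      moreover have "t 0 + t 0 \<noteq> 0" using t0 by (metis mult_2 mult_eq_0_iff zero_neq_numeral)
      ultimately show ?thesis by (intro tendsto_intros)
    qed
    then have "((\<lambda>z. (z - t 0) * good z - (t 0)\<^sup>2 / (t 0 + z) * res z) \<longlongrightarrow> 0) (at (t 0))"
      by (simp add: res0)
    moreover have "\<forall>\<^sub>F z in at (t 0). (z - t 0) * good z - (t 0)\<^sup>2 / (t 0 + z) * res z = (z - t 0) * G0 (t(0 := z))"
    proof -
      have "\<forall>\<^sub>F z in at (t 0). z \<in> {z. t(0 := z) \<in> V0} - {t 0}"
        using op t by (intro eventually_at_in_open) auto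
      then show ?thesis
      proof (rule eventually_mono)
        fix z assume "z \<in> {z. t(0 := z) \<in> V0} - {t 0}"
        then have z: "t(0 := z) \<in> V0" "z \<noteq> t 0" by auto
        have zD: "t(0 := z) \<notin> D" using D_one[OF J0(1), of t z "t 0"] z t by auto
        have "w t = t 0 * (r ^ m * (\<Prod>j\<in>J - {0}. t j))" using w_upd[OF J0(1), of t "t 0"] by simp
        then have "w (t(0 := z)) = z / t 0"
          using t t0 w_upd[OF J0(1), of t z] by (simp add: D_def field_simps)
        then have mz: "mon q (t(0 := z)) m J = z\<^sup>2 / (t 0)\<^sup>2" by (simp add: mon_w power_divide)
        have nz: "1 - mon q (t(0 := z)) m J \<noteq> 0" using mon1[of "t(0 := z)"] z zD by auto
        have zt: "z + t 0 \<noteq> 0" "z - t 0 \<noteq> 0"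
        proof -
          have "z\<^sup>2 \<noteq> (t 0)\<^sup>2" using nz t0 by (auto simp: mz)
          then show "z + t 0 \<noteq> 0" "z - t 0 \<noteq> 0" by (auto simp: power2_eq_iff eq_neg_iff_add_eq_0)
        qed
        have "F I (t(0 := z)) = good z + 1 / (1 - mon q (t(0 := z)) m J) * (bo_sum q X I bad (t(0 := z)) / Z)"
        proof -
          have "bo_sum q {} I A (t(0 := z)) = bo_sum q X I (A - bad) (t(0 := z)) +
              1 / (1 - mon q (t(0 := z)) m J) * bo_sum q X I bad (t(0 := z))"
            unfolding A_def X_def bad_def
            by (rule bo_sum_split[OF m]) (use Vlim[of "t(0 := z)"] Vsum[of "t(0 := z)"] z V0 in \<open>auto simp: X_def simp del: fun_upd_apply\<close>)
          moreover have "t(0 := z) \<in> region I - divs q I" using VDreg z zD by blast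
          ultimately show ?thesis
            unfolding good_def F_eq[OF fin(1) \<open>t(0 := z) \<in> region I - divs q I\<close>] by (simp add: A_def add_divide_distrib)
        qed
        moreover have "c / (mon q (t(0 := z)) m J - 1) = - (c / (1 - mon q (t(0 := z)) m J))"
          by (metis minus_diff_eq minus_divide_right)
        ultimately have "G0 (t(0 := z)) = good z + 1 / (1 - mon q (t(0 := z)) m J) * res z"
          unfolding G0_def Y_eq[OF z(1)] res_def by (simp add: algebra_simps)
        moreover have "(z - t 0) * (1 / (1 - mon q (t(0 := z)) m J)) = - ((t 0)\<^sup>2 / (t 0 + z))"
        proof -
          have fact: "1 - mon q (t(0 := z)) m J = - ((z - t 0) * (t 0 + z) / (t 0)\<^sup>2)"
            unfolding mz using t0 by (simp add: field_simps power2_eq_square)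
          have "(z - t 0) * (1 / - ((z - t 0) * (t 0 + z) / (t 0)\<^sup>2)) = - ((t 0)\<^sup>2 / (t 0 + z))"
            using zt t0 by (simp add: add.commute)
          then show ?thesis by (simp only: fact)
        qed
        ultimately show "(z - t 0) * good z - (t 0)\<^sup>2 / (t 0 + z) * res z = (z - t 0) * G0 (t(0 := z))"
          by (simp only: distrib_left mult.assoc[symmetric]) simp
      qed
    qed
    ultimately show ?thesis by (rule Lim_transform_eventually)
  qed
  have "\<exists>U G. p \<in> U \<and> U \<subseteq> V0 \<and> holo_in I U G \<and> (\<forall>t\<in>U - D. G t = G0 t)"
  proof (rule extend_across[OF V0(1,2) _ G0_holo J0(2)])
    show "p \<in> D" using p_div by (simp add: D_def w_def J_def)
    show "z = z'" if "t(0 := z) \<in> D" "t(0 := z') \<in> D" for t z z' using D_one[OF J0(1)] that by blast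
    \<comment> \<open>\<open>w\<close> is linear in each coordinate of \<open>J\<close> and
      independent of the others.\<close>
    show "(\<forall>t z z'. t(i := z) \<in> D \<longrightarrow> t(i := z') \<in> D \<longrightarrow> z = z') \<or> (\<forall>t z. t(i := z) \<in> D \<longleftrightarrow> t \<in> D)" for i
    proof (cases "i \<in> J")
      case True
      then show ?thesis using D_one[OF True] by blast
    next
      case False
      then show ?thesis using w_upd'[OF False] by (simp add: D_def)
    qed
  qed (rule lim0)
  then obtain U G where UG: "p \<in> U" "U \<subseteq> V0" "holo_in I U G" "\<And>t. t \<in> U - D \<Longrightarrow> G t = G0 t" by blast
  have "F I t = c / (q ^ m * (\<Prod>j\<in>J. (t j)\<^sup>2) - 1) * (F K t / (\<Prod>j\<in>K. (t j)\<^sup>2) ^ m) + G t" if "t \<in> U - divs q I" for t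
    using UG(4)[of t] that divs_D[of t] UG(2) by (auto simp: G0_def Y_def mon_def)
  then show ?thesis
    using UG V0 V unfolding I_def J_def K_def c_def by blast
qed

end
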